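(* Suppose the noise condition holds for some $\alpha,\gamma\ge0$, i.e., $\mathbb P_X(0<\Delta(X)\le\delta)\le(\gamma\delta/B)^\alpha$ for all $\delta>0$; suppose $\mathbb P(|\mathcal Z^*(X)|>1)=0$; suppose $\Pi\subseteq[\mathbb R^p\to\mathcal Z^\angle]$ has Natarajan dimension at most $\eta$; and suppose $\pi^*\in\Pi$. Then, for a constant $C(\alpha,\gamma)$ depending only on $\alpha,\gamma$, $$\mathrm{Regret}(\hat \pi^{\mathrm{ERM}}_{\Pi})\leq C(\alpha, \gamma)\, B \left(\frac{\eta\log(|\mathcal Z^\angle|+1)\log(n+1)}{n}\right)^{\frac{1+\alpha}{2+\alpha}}.$$
   Context: Setting: $X\in\mathbb R^p$, $Y\in\mathbb R^d$ with $\|Y\|\le1$, $f^*(x)=\mathbb E[Y\mid X=x]$. $\mathcal Z=\{z\in\mathbb R^d:Az\le b\}$ is a polytope with $\sup_{z\in\mathcal Z}\|z\|\le B$ and finite set of extreme points $\mathcal Z^\angle$; $\mathcal Z^*(x)=\arg\min_{z\in\mathcal Z}f^*(x)^\top z$, $\pi^*(x)\in\mathcal Z^*(x)$. $\Delta(x)=\inf_{z\in\mathcal Z^\angle\setminus\mathcal Z^*(x)}f^*(x)^\top z-\inf_{z\in\mathcal Z}f^*(x)^\top z$ if $\mathcal Z^*(x)\ne\mathcal Z$, and $\Delta(x)=0$ otherwise. Data $\mathcal D=\{(X_i,Y_i)\}_{i=1}^n$ i.i.d.; $\mathrm{Regret}(\hat\pi)=\mathbb E_{\mathcal D}\mathbb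 E_X[f^*(X)^\top(\hat\pi(X)-\pi^*(X))]$, $X$ independent new draw. $\hat\pi^{\mathrm{ERM}}_\Pi\in\arg\min_{\pi\in\Pi}\frac1n\sum_{i=1}^nY_i^\top\pi(X_i)$. The Natarajan dimension of $\mathcal G\subseteq[\mathbb R^p\to\mathcal S]$ is the largest $\eta$ for which there exist $x_1,\dots,x_\eta$ and $s_k\neq s_k'$ with $\{(\mathbb I\{g(x_k)=s_k\})_{k=1}^\eta:g\in\mathcal G,\ g(x_k)\in\{s_k,s_k'\}\ \forall k\}=\{0,1\}^\eta$. *)

theory Defs
  imports "HOL-Probability.Probability"
begin

text \<open>Vectors of R^k are represented by functions nat => real that vanish
  outside {..<k}; this lets the dimensions p and d be quantified inside the
  statement (the constant C must not depend on them).\<close>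

definition vecs :: "nat \<Rightarrow> (nat \<Rightarrow> real) set" where
  "vecs k = {z. \<forall>i\<ge>k. z i = 0}"

definition ip :: "nat \<Rightarrow> (nat \<Rightarrow> real) \<Rightarrow> (nat \<Rightarrow> real) \<Rightarrow> real" where
  "ip k y z = (\<Sum>i<k. y i * z i)"

definition vnorm :: "nat \<Rightarrow> (nat \<Rightarrow> real) \<Rightarrow> real" where
  "vnorm k z = sqrt (ip k z z)"

definition is_Hpoly :: "nat \<Rightarrow> (nat \<Rightarrow> real) set \<Rightarrow> bool" where
  "is_Hpoly d Z \<longleftrightarrow> (\<exists>(m::nat) (a::nat \<Rightarrow> nat \<Rightarrow> real) (b::nat \<Rightarrow> real).
      (\<forall>j<m. a j \<in> vecs d) \<and> Z = {z \<in> vecs d. \<forall>j<m. ip d (a j) z \<le> b j})"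

text \<open>Extreme points (unfolding of the library's extreme_point_of:
  z is not in any open segment between points of Z).\<close>
definition ext_pts :: "(nat \<Rightarrow> real) set \<Rightarrow> (nat \<Rightarrow> real) set" where
  "ext_pts Z = {z \<in> Z. \<forall>u\<in>Z. \<forall>v\<in>Z. \<forall>t::real. 0 < t \<and> t < 1 \<and>
        z = (\<lambda>i. (1 - t) * u i + t * v i) \<longrightarrow> u = v}"

definition zstar :: "nat \<Rightarrow> (nat \<Rightarrow> real) set \<Rightarrow> ((nat \<Rightarrow> real) \<Rightarrow> (nat \<Rightarrow> real))
    \<Rightarrow> (nat \<Rightarrow> real) \<Rightarrow> (nat \<Rightarrow> real) set" where
  "zstar d Z f x = {z \<in> Z. \<forall>w\<in>Z. ip d (f x) z \<le> ip d (f x) w}"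

definition gap :: "nat \<Rightarrow> (nat \<Rightarrow> real) set \<Rightarrow> ((nat \<Rightarrow> real) \<Rightarrow> (nat \<Rightarrow> real))
    \<Rightarrow> (nat \<Rightarrow> real) \<Rightarrow> real" where
  "gap d Z f x = (if zstar d Z f x \<noteq> Z
      then Inf ((\<lambda>z. ip d (f x) z) ` (ext_pts Z - zstar d Z f x)) - Inf ((\<lambda>z. ip d (f x) z) ` Z)
      else 0)"

text \<open>Real power with the convention t^0 = 1 (also for t = 0).\<close>
definition rpow :: "real \<Rightarrow> real \<Rightarrow> real" where
  "rpow t a = (if a = 0 then 1 else t powr a)"

definition nat_shatters :: "'x set \<Rightarrow> ('x \<Rightarrow> 's) set \<Rightarrow> nat \<Rightarrow> bool" where
  "nat_shatters Dom G m \<longleftrightarrow> (\<exists>(xs::nat \<Rightarrow> 'x) (s::nat \<Rightarrow> 's) (s'::nat \<Rightarrow> 's).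
      (\<forall>k<m. xs k \<in> Dom \<and> s k \<noteq> s' k) \<and>
      (\<lambda>g. restrict (\<lambda>k. g (xs k) = s k) {..<m}) ` {g \<in> G. \<forall>k<m. g (xs k) \<in> {s k, s' k}}
        = ({..<m} \<rightarrow>\<^sub>E (UNIV :: bool set)))"

definition natarajan_dim :: "'x set \<Rightarrow> ('x \<Rightarrow> 's) set \<Rightarrow> enat" where
  "natarajan_dim Dom G = Sup {enat m | m. nat_shatters Dom G m}"

end

theory Submission
  imports Defs
begin

text \<open>
  For a policy \<open>\<pi>\<close> let \<open>R\<close> be its excess risk and \<open>t\<close> the probability that it disagrees with
  \<open>pistar\<close>. Since the optimum is almost surely unique, a disagreement costs at least the gap, so the
  noise condition gives \<open>R \<ge> \<epsilon> B t - c B \<epsilon> powr (1 + \<alpha>)\<close> for every \<open>\<epsilon> > 0\<close>, hence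
  \<open>R \<le> (2 R - \<epsilon> B t) + c B \<epsilon> powr (1 + \<alpha>)\<close>. For the empirical minimiser the empirical
  excess loss is nonpositive, so the bracket is at most a difference between a ghost sample and the
  sample, minus an offset proportional to the number of disagreements. Randomly swapping the two
  samples, the offset dominates the variance of the random signs, and the expected maximum over the
  finitely many behaviours on the double sample is at most a constant times \<open>B ln N / (n \<epsilon>)\<close>.
  Natarajan's lemma gives \<open>N \<le> (1 + 2 n K\<^sup>2) ^ \<eta>\<close>, where \<open>K\<close> is the number of extreme points.
  The choice \<open>\<epsilon> = (\<eta> ln (K + 1) ln (n + 1) / n) powr (1 / (2 + \<alpha>))\<close> balances the two terms.
\<close>

subsection \<open>Natarajan's lemma and random signs\<close>

text \<open>Natarajan shattering of a set of points rather than of an indexed family, the form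
  suited to induction over finite sets; \<open>T\<close> marks the points where the first witness
  \<open>s\<close> is taken.\<close>

definition shatters_on :: "('x \<Rightarrow> 's) set \<Rightarrow> 'x set \<Rightarrow> bool" where
  "shatters_on H S \<longleftrightarrow> (\<exists>s s'. (\<forall>x\<in>S. s x \<noteq> s' x) \<and>
     (\<forall>T\<subseteq>S. \<exists>h\<in>H. \<forall>x\<in>S. h x = (if x \<in> T then s x else s' x)))"

text \<open>Shattering only sees the values on \<open>S\<close>, so the class may be enlarged, and
  restrictions or updates away from \<open>S\<close> may be undone.\<close>

lemma shatters_on_transfer:
  assumes "shatters_on H S" and H: "\<And>h. h \<in> H \<Longrightarrow> \<exists>h'\<in>H'. \<forall>x\<in>S. h' x = h x"
  shows "shatters_on H' S"
proof -
  obtain s s' where s: "\<forall>x\<in>S. s x \<noteq> s' x"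
    and T: "\<And>T. T \<subseteq> S \<Longrightarrow> \<exists>h\<in>H. \<forall>x\<in>S. h x = (if x \<in> T then s x else s' x)"
    using assms(1) unfolding shatters_on_def by blast
  have "\<exists>h\<in>H'. \<forall>x\<in>S. h x = (if x \<in> T then s x else s' x)" if TS: "T \<subseteq> S" for T
  proof -
    obtain h where h: "h \<in> H" "\<forall>x\<in>S. h x = (if x \<in> T then s x else s' x)" using T[OF TS] by blast
    obtain h' where "h' \<in> H'" "\<forall>x\<in>S. h' x = h x" using H[OF h(1)] by blast
    then show ?thesis using h(2) by (intro bexI[of _ h']) simp_all
  qed
  then show ?thesis using s unfolding shatters_on_def by blast
qed

text \<open>The witnesses at \<open>x\<close> are \<open>y\<close> and \<open>y'\<close>: a function
  realising a pattern on \<open>S\<close> has both updates at \<open>x\<close> in \<open>H\<close>,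
  so the pattern extends either way.\<close>

lemma shatters_on_insert:
  assumes "x \<notin> X" "S \<subseteq> X" "y \<noteq> y'"
    and "shatters_on {h. h(x := y) \<in> H \<and> h(x := y') \<in> H} S"
  shows "shatters_on H (insert x S)"
proof -
  obtain s s' where s: "\<forall>x\<in>S. s x \<noteq> s' x"
    and T: "\<And>T. T \<subseteq> S \<Longrightarrow> \<exists>h. h(x := y) \<in> H \<and> h(x := y') \<in> H \<and> (\<forall>x\<in>S. h x = (if x \<in> T then s x else s' x))"
    using assms(4) unfolding shatters_on_def by (auto simp: Bex_def)
  have xS: "x \<notin> S" using assms by auto
  show ?thesis unfolding shatters_on_def
  proof (rule exI[of _ "s(x := y)"], rule exI[of _ "s'(x := y')"], intro conjI allI impI)
    show "\<forall>z\<in>insert x S. (s(x := y)) z \<noteq> (s'(x := y')) z" using s assms(3) by auto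
    fix T assume TS: "T \<subseteq> insert x S"
    obtain h where h: "h(x := y) \<in> H" "h(x := y') \<in> H" "\<forall>z\<in>S. h z = (if z \<in> T - {x} then s z else s' z)"
      using T[of "T - {x}"] TS by blast
    show "\<exists>h\<in>H. \<forall>z\<in>insert x S. h z = (if z \<in> T then (s(x := y)) z else (s'(x := y')) z)"
    proof (cases "x \<in> T")
      case True
      show ?thesis by (rule bexI[OF _ h(1)]) (use h(3) xS True in auto)
    next
      case False
      show ?thesis by (rule bexI[OF _ h(2)]) (use h(3) xS False in auto)
    qed
  qed
qed

text \<open>Each trace on \<open>X\<close> keeps one canonical extension to \<open>x\<close>,
  counted by the first term. Any other member of \<open>H\<close> is recorded by the canonical
  value, its own value at \<open>x\<close>, and its trace, which then extends in both ways.\<close>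

lemma natarajan_card_step:
  assumes fin: "finite X" "finite Y" and x: "x \<notin> X" and H: "H \<subseteq> insert x X \<rightarrow>\<^sub>E Y"
  defines "Hp \<equiv> \<lambda>(y, y'). {h \<in> X \<rightarrow>\<^sub>E Y. h(x := y) \<in> H \<and> h(x := y') \<in> H}"
  shows "card H \<le> card ((\<lambda>h. restrict h X) ` H) + (\<Sum>yy\<in>{(y, y') \<in> Y \<times> Y. y \<noteq> y'}. card (Hp yy))"
proof -
  let ?r = "\<lambda>h. restrict h X"
  let ?Q = "{(y, y') \<in> Y \<times> Y. y \<noteq> y'}"
  have finH: "finite H" using H fin by (meson finite_PiE finite_insert finite_subset)
  have finQ: "finite ?Q" by (rule finite_subset[of _ "Y \<times> Y"]) (use fin in auto)
  have finHp: "finite (Hp yy)" for yy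
    by (rule finite_subset[of _ "X \<rightarrow>\<^sub>E Y"]) (use fin in \<open>auto simp: Hp_def finite_PiE split: prod.splits\<close>)
  have upd: "(?r h)(x := h x) = h" if "h \<in> H" for h
  proof -
    have "h \<in> extensional (insert x X)" using that H by (auto simp: PiE_def)
    then show ?thesis using x by (auto simp: fun_eq_iff extensional_def)
  qed
  define c where "c h' = (SOME y. h'(x := y) \<in> H)" for h'
  have c: "(?r h)(x := c (?r h)) \<in> H" if "h \<in> H" for h
    unfolding c_def by (rule someI[of _ "h x"]) (simp only: upd that)
  have rX: "?r h \<in> X \<rightarrow>\<^sub>E Y" if "h \<in> H" for h using that H by (auto simp: PiE_iff)
  have hx: "h x \<in> Y" if "h \<in> H" for h using that H by (auto simp: PiE_iff)
  have cY: "c (?r h) \<in> Y" if "h \<in> H" for h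
    using hx[OF c[OF that]] by simp
  let ?H1 = "{h \<in> H. h x = c (?r h)}" and ?H2 = "{h \<in> H. h x \<noteq> c (?r h)}"
  have "card ?H1 \<le> card (?r ` H)"
  proof (rule card_inj_on_le)
    show "inj_on ?r ?H1" by (rule inj_onI) (use upd in \<open>metis (mono_tags, lifting) mem_Collect_eq\<close>)
  qed (use finH in auto)
  moreover have "card ?H2 \<le> card (SIGMA yy:?Q. Hp yy)"
  proof (rule card_inj_on_le)
    \<comment> \<open>The trace together with the actual value at \<open>x\<close> recovers
      \<open>h\<close>.\<close>
    show "inj_on (\<lambda>h. ((c (?r h), h x), ?r h)) ?H2"
      by (rule inj_onI) (use upd in \<open>metis (mono_tags, lifting) mem_Collect_eq prod.inject\<close>)
    show "(\<lambda>h. ((c (?r h), h x), ?r h)) ` ?H2 \<subseteq> (SIGMA yy:?Q. Hp yy)"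
    proof (rule image_subsetI)
      fix h assume h: "h \<in> ?H2"
      define k where "k = ?r h"
      have "c k \<in> Y" "h x \<in> Y" "k \<in> X \<rightarrow>\<^sub>E Y" "k(x := c k) \<in> H" "k(x := h x) = h" "h \<in> H" "h x \<noteq> c k"
        using cY hx rX c upd h unfolding k_def by blast+
      then show "((c (?r h), h x), ?r h) \<in> (SIGMA yy:?Q. Hp yy)"
        unfolding k_def[symmetric] Hp_def by simp
    qed
    show "finite (SIGMA yy:?Q. Hp yy)" using finQ finHp by blast
  qed
  moreover have "card (SIGMA yy:?Q. Hp yy) = (\<Sum>yy\<in>?Q. card (Hp yy))"
    using finQ finHp by (intro card_SigmaI) auto
  moreover have "card H = card ?H1 + card ?H2"
    by (subst card_Un_disjoint[symmetric]) (use finH in \<open>auto intro!: arg_cong[of _ _ card]\<close>)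
  ultimately show ?thesis by linarith
qed

text \<open>Induction on \<open>X\<close>: the traces inherit the bound \<open>\<eta>\<close>, while
  each class of doubly extendable functions loses one dimension, because any set it shatters can be
  enlarged by \<open>x\<close>.\<close>

lemma natarajan_card_bound:
  assumes "finite X" "finite Y" "H \<subseteq> X \<rightarrow>\<^sub>E Y"
    and "\<And>S. S \<subseteq> X \<Longrightarrow> shatters_on H S \<Longrightarrow> card S \<le> \<eta>"
  shows "card H \<le> (1 + card X * (card Y)\<^sup>2) ^ \<eta>"
  using assms(1,3,4)
proof (induction X arbitrary: H \<eta> rule: finite_induct)
  case empty
  have "card H \<le> card {\<lambda>_ :: 'a. undefined :: 'b}"
    using empty.prems(1) by (intro card_mono) auto
  then show ?case by simp
next
  case (insert x X)
  let ?Q = "{(y, y') \<in> Y \<times> Y. y \<noteq> y'}"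
  let ?H' = "(\<lambda>h. restrict h X) ` H"
  define Hp where "Hp = (\<lambda>(y, y'). {h \<in> X \<rightarrow>\<^sub>E Y. h(x := y) \<in> H \<and> h(x := y') \<in> H})"
  define u where "u = 1 + card X * (card Y)\<^sup>2"
  have step: "card H \<le> card ?H' + (\<Sum>yy\<in>?Q. card (Hp yy))"
    unfolding Hp_def by (rule natarajan_card_step) (use insert assms(2) in auto)
  have up: "shatters_on H (insert x S)" if yQ: "yy \<in> ?Q" and "shatters_on (Hp yy) S" "S \<subseteq> X" for yy S
  proof -
    obtain y y' where yy: "yy = (y, y')" "y \<noteq> y'" using yQ by auto
    have "shatters_on {h. h(x := y) \<in> H \<and> h(x := y') \<in> H} S"
      using that(2) unfolding Hp_def yy by (rule shatters_on_transfer) auto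
    then show ?thesis using shatters_on_insert[OF insert.hyps(2) that(3) yy(2)] by blast
  qed
  have H': "card ?H' \<le> u ^ \<eta>" unfolding u_def
  proof (rule insert.IH)
    show "?H' \<subseteq> X \<rightarrow>\<^sub>E Y" using insert.prems(1) by (auto simp: PiE_iff)
    fix S assume S: "S \<subseteq> X" "shatters_on ?H' S"
    have "shatters_on H S"
    proof (rule shatters_on_transfer[OF S(2)])
      fix h assume "h \<in> ?H'"
      then obtain h0 where "h0 \<in> H" "h = restrict h0 X" by auto
      then show "\<exists>h'\<in>H. \<forall>x\<in>S. h' x = h x" using S(1) by (intro bexI[of _ h0]) auto
    qed
    then show "card S \<le> \<eta>" using insert.prems(2)[of S] S by auto
  qed
  show ?case
  proof (cases \<eta>)
    case 0
    have "Hp yy = {}" if "yy \<in> ?Q" for yy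
    proof (rule ccontr)
      \<comment> \<open>A nonempty class shatters the empty set, so \<open>H\<close> would shatter
        \<open>{x}\<close>, which \<open>\<eta> = 0\<close> excludes.\<close>
      assume "Hp yy \<noteq> {}"
      then have "shatters_on (Hp yy) {}" by (auto simp: shatters_on_def)
      from insert.prems(2)[OF _ up[OF that this]] show False using 0 by simp
    qed
    then have "(\<Sum>yy\<in>?Q. card (Hp yy)) = 0" by (intro sum.neutral) auto
    then show ?thesis using step H' 0 by simp
  next
    case (Suc k)
    have Hk: "card (Hp yy) \<le> u ^ k" if yy: "yy \<in> ?Q" for yy unfolding u_def
    proof (rule insert.IH)
      show "Hp yy \<subseteq> X \<rightarrow>\<^sub>E Y" by (auto simp: Hp_def split: prod.splits)
      fix S assume S: "S \<subseteq> X" "shatters_on (Hp yy) S"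
      have "card (insert x S) \<le> Suc k"
        using insert.prems(2)[OF _ up[OF yy S(2,1)]] S Suc by auto
      moreover have "finite S" "x \<notin> S" using S insert.hyps by (auto intro: finite_subset)
      ultimately show "card S \<le> k" by simp
    qed
    have "card ?Q \<le> card (Y \<times> Y)" using assms(2) by (intro card_mono) auto
    then have cQ: "card ?Q \<le> (card Y)\<^sup>2" by (simp add: card_cartesian_product power2_eq_square)
    have "(\<Sum>yy\<in>?Q. card (Hp yy)) \<le> card ?Q * u ^ k"
      using sum_bounded_above[of ?Q "\<lambda>yy. card (Hp yy)" "u ^ k"] Hk by simp
    also have "\<dots> \<le> (card Y)\<^sup>2 * u ^ k" using cQ by simp
    finally have "card H \<le> u ^ k * (u + (card Y)\<^sup>2)" using step H' Suc by (simp add: algebra_simps)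
    \<comment> \<open>The enlarged base is exactly the one that belongs to
      \<open>insert x X\<close>.\<close>
    also have "\<dots> \<le> (u + (card Y)\<^sup>2) ^ k * (u + (card Y)\<^sup>2)"
      by (intro mult_right_mono power_mono) auto
    also have "\<dots> = (1 + card (insert x X) * (card Y)\<^sup>2) ^ \<eta>"
      using insert.hyps by (simp add: u_def Suc algebra_simps)
    finally show ?thesis .
  qed
qed

text \<open>A set shattered by the traces, once enumerated by a bijection, is an instance of
  \<open>nat_shatters\<close>, so its size is at most the dimension and the counting bound
  applies.\<close>

lemma card_restrict_image_natarajan:
  fixes G :: "('x \<Rightarrow> 's) set"
  assumes X: "finite X" "X \<subseteq> Dom" and Y: "finite Y" "\<And>g x. g \<in> G \<Longrightarrow> x \<in> X \<Longrightarrow> g x \<in> Y"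
    and dim: "natarajan_dim Dom G \<le> enat \<eta>"
  shows "card ((\<lambda>g. restrict g X) ` G) \<le> (1 + card X * (card Y)\<^sup>2) ^ \<eta>"
proof (rule natarajan_card_bound[OF X(1) Y(1)])
  show "(\<lambda>g. restrict g X) ` G \<subseteq> X \<rightarrow>\<^sub>E Y" using Y(2) by auto
  fix S assume S: "S \<subseteq> X" "shatters_on ((\<lambda>g. restrict g X) ` G) S"
  let ?m = "card S"
  obtain s s' where ss: "\<forall>x\<in>S. s x \<noteq> s' x"
    and T: "\<And>T. T \<subseteq> S \<Longrightarrow> \<exists>g\<in>G. \<forall>x\<in>S. restrict g X x = (if x \<in> T then s x else s' x)"
    using S(2) unfolding shatters_on_def by auto
  have "finite S" using S X finite_subset by blast
  then obtain e where e: "bij_betw e {..<?m} S"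
    using ex_bij_betw_nat_finite[of S] by (auto simp: atLeast0LessThan)
  have eS: "e k \<in> S" if "k < ?m" for k using e that by (auto simp: bij_betw_def)
  have "nat_shatters Dom G ?m"
    unfolding nat_shatters_def
  proof (rule exI[of _ e], rule exI[of _ "\<lambda>k. s (e k)"], rule exI[of _ "\<lambda>k. s' (e k)"], intro conjI)
    show "\<forall>k<?m. e k \<in> Dom \<and> s (e k) \<noteq> s' (e k)" using eS ss S(1) X(2) by blast
    show "(\<lambda>g. restrict (\<lambda>k. g (e k) = s (e k)) {..<?m}) `
        {g \<in> G. \<forall>k<?m. g (e k) \<in> {s (e k), s' (e k)}} = ({..<?m} \<rightarrow>\<^sub>E UNIV)" (is "?L = ?R")
    proof
      show "?R \<subseteq> ?L"
      proof
        fix b :: "nat \<Rightarrow> bool" assume b: "b \<in> ?R"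
        \<comment> \<open>The Boolean pattern \<open>b\<close> becomes the subset of
          \<open>S\<close> enumerated by the indices where \<open>b\<close> holds.\<close>
        obtain g where g: "g \<in> G"
          and gT: "\<forall>x\<in>S. restrict g X x = (if x \<in> e ` {k. k < ?m \<and> b k} then s x else s' x)"
          using T[of "e ` {k. k < ?m \<and> b k}"] eS by blast
        have "g (e k) = (if b k then s (e k) else s' (e k))" if k: "k < ?m" for k
        proof -
          have "e k \<in> e ` {k. k < ?m \<and> b k} \<longleftrightarrow> b k"
            using e k unfolding bij_betw_def inj_on_def by auto
          moreover have "restrict g X (e k) = g (e k)" using eS[OF k] S(1) by auto
          ultimately show ?thesis using bspec[OF gT eS[OF k]] by (simp only:)
        qed
        note gk = this
        have "b = restrict (\<lambda>k. g (e k) = s (e k)) {..<?m}"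
        proof
          fix k
          show "b k = restrict (\<lambda>k. g (e k) = s (e k)) {..<?m} k"
          proof (cases "k < ?m")
            case True
            then show ?thesis using gk[OF True] eS[OF True] ss by auto
          next
            case False
            then show ?thesis using b by (auto simp: PiE_def extensional_def)
          qed
        qed
        moreover have "\<forall>k<?m. g (e k) \<in> {s (e k), s' (e k)}" using gk by (metis insertCI)
        ultimately show "b \<in> ?L" using g by blast
      qed
    qed auto
  qed
  then have "enat ?m \<le> natarajan_dim Dom G"
    unfolding natarajan_dim_def by (intro Sup_upper) blast
  then show "?m \<le> \<eta>" using dim by (metis enat_ord_simps(1) order_trans)
qed

text \<open>Exponential moment of a random sign: the sum of \<open>exp x\<close> and
  \<open>exp (- x)\<close> is at most \<open>2 + 2 * x\<^sup>2\<close>, and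
  \<open>1 + x\<^sup>2 \<le> exp e\<close> lets the offset cancel the second-order term.\<close>

lemma exp_add_exp_minus_le:
  fixes x e :: real
  assumes "\<bar>x\<bar> \<le> 1" "x\<^sup>2 \<le> e"
  shows "exp (x - e) + exp (- x - e) \<le> 2"
proof -
  have *: "exp y + exp (- y) \<le> 2 + 2 * y\<^sup>2" if y: "0 \<le> y" "y \<le> 1" for y :: real
  proof -
    \<comment> \<open>The product is \<open>1 + y ^ 3\<close>; it yields a quadratic upper bound on
      \<open>exp (- y)\<close> that matches \<open>exp_bound\<close>.\<close>
    have "1 \<le> (1 + y) * (1 - y + y\<^sup>2)" using y by (simp add: algebra_simps power2_eq_square)
    also have "\<dots> \<le> exp y * (1 - y + y\<^sup>2)"
      using y by (intro mult_right_mono) auto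
    finally have "exp (- y) \<le> 1 - y + y\<^sup>2" by (simp add: exp_minus field_simps)
    then show ?thesis using exp_bound[OF y] by simp
  qed
  have "exp x + exp (- x) \<le> 2 + 2 * x\<^sup>2"
    using *[of x] *[of "- x"] assms(1) by (cases "0 \<le> x") auto
  also have "\<dots> \<le> 2 * exp e" using exp_ge_add_one_self[of e] assms(2) by linarith
  finally have "(exp x + exp (- x)) * exp (- e) \<le> 2 * exp e * exp (- e)" by (intro mult_right_mono) auto
  also have "2 * exp e * exp (- e) = 2" by (simp add: exp_minus)
  finally show ?thesis by (simp add: exp_diff exp_minus field_simps)
qed

text \<open>The offset \<open>e\<close> exactly absorbs the variance of the random signs, so the maximum
  over \<open>V\<close> costs only \<open>ln N\<close>; \<open>t \<le> exp t / N - 1 + ln N\<close> replaces Jensen's inequality.\<close>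
lemma sum_signs_offset_le:
  fixes a e :: "'v \<Rightarrow> nat \<Rightarrow> real"
  assumes V: "finite V" "real (card V) \<le> N" "\<And>S. S \<subseteq> {..<n} \<Longrightarrow> sel S \<in> V"
    and a: "\<And>v i. v \<in> V \<Longrightarrow> i < n \<Longrightarrow> \<bar>a v i\<bar> \<le> 1" "\<And>v i. v \<in> V \<Longrightarrow> i < n \<Longrightarrow> (a v i)\<^sup>2 \<le> e v i"
  shows "(\<Sum>S\<in>Pow {..<n}. \<Sum>i<n. (if i \<in> S then a (sel S) i else - a (sel S) i) - e (sel S) i) \<le> 2 ^ n * ln N"
proof -
  define \<psi> where "\<psi> v S = (\<Sum>i<n. (if i \<in> S then a v i else - a v i) - e v i)" for v S
  have "V \<noteq> {}" using V(3)[of "{}"] by auto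
  then have N: "N > 0" using V by (smt (verit) card_gt_0_iff of_nat_0_less_iff)
  have young: "t \<le> exp t / N - 1 + ln N" for t
    using exp_ge_add_one_self[of "t - ln N"] N by (simp add: exp_diff)
  \<comment> \<open>For fixed \<open>v\<close> the sum over all sign patterns factorises over the
    indices, and each factor is at most 2.\<close>
  have expand: "(\<Sum>S\<in>Pow {..<n}. exp (\<psi> v S)) \<le> 2 ^ n" if v: "v \<in> V" for v
  proof -
    have "exp (\<psi> v S) = (\<Prod>i\<in>S. exp (a v i - e v i)) * (\<Prod>i\<in>{..<n} - S. exp (- a v i - e v i))"
      if "S \<in> Pow {..<n}" for S
    proof -
      have "\<psi> v S = (\<Sum>i\<in>S. a v i - e v i) + (\<Sum>i\<in>{..<n} - S. - a v i - e v i)"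
        unfolding \<psi>_def using that
        by (subst sum.subset_diff[of S]) (auto simp: add.commute intro!: arg_cong2[of _ _ _ _ "(+)"] sum.cong)
      then show ?thesis using that by (auto simp: exp_add exp_sum finite_subset)
    qed
    then have "(\<Sum>S\<in>Pow {..<n}. exp (\<psi> v S)) = (\<Prod>i<n. exp (a v i - e v i) + exp (- a v i - e v i))"
      by (simp add: prod_add)
    also have "\<dots> \<le> (\<Prod>i<n. 2)"
      using a[OF v] by (intro prod_mono) (auto intro!: exp_add_exp_minus_le add_nonneg_nonneg)
    finally show ?thesis by simp
  qed
  have "(\<Sum>S\<in>Pow {..<n}. \<psi> (sel S) S) \<le> (\<Sum>S\<in>Pow {..<n}. (\<Sum>v\<in>V. exp (\<psi> v S)) / N - 1 + ln N)"
  proof (rule sum_mono)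
    fix S assume "S \<in> Pow {..<n}"
    \<comment> \<open>Since \<open>sel S\<close> varies with the signs, its exponential is dominated
      by the sum over all of \<open>V\<close>; afterwards the two sums can be exchanged.\<close>
    then have "exp (\<psi> (sel S) S) \<le> (\<Sum>v\<in>V. exp (\<psi> v S))"
      using V by (intro member_le_sum) auto
    then show "\<psi> (sel S) S \<le> (\<Sum>v\<in>V. exp (\<psi> v S)) / N - 1 + ln N"
      using young[of "\<psi> (sel S) S"] N by (smt (verit) divide_right_mono)
  qed
  also have "\<dots> = (\<Sum>v\<in>V. \<Sum>S\<in>Pow {..<n}. exp (\<psi> v S)) / N + 2 ^ n * (ln N - 1)"
    by (subst sum.swap) (simp add: sum.distrib sum_subtractf sum_divide_distrib card_Pow algebra_simps)
  also have "\<dots> \<le> (\<Sum>v\<in>V. 2 ^ n) / N + 2 ^ n * (ln N - 1)"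
    using N expand by (intro add_right_mono divide_right_mono sum_mono) auto
  also have "\<dots> \<le> 2 ^ n + 2 ^ n * (ln N - 1)"
    using N V(2) by (simp add: field_simps)
  finally show ?thesis by (simp add: \<psi>_def algebra_simps)
qed

subsection \<open>Symmetrization with an offset\<close>

lemma (in prob_space) integrable_bounded_abs:
  fixes F :: "'a \<Rightarrow> real"
  assumes "F \<in> borel_measurable M" "\<And>\<omega>. \<omega> \<in> space M \<Longrightarrow> \<bar>F \<omega>\<bar> \<le> b"
  shows "integrable M F"
  using assms by (intro integrable_const_bound[of _ b]) (auto intro!: AE_I2)

locale ghost_sample = prob_space M for M :: "'z measure" +
  fixes n :: nat
begin

abbreviation "Mn \<equiv> PiM {..<n} (\<lambda>_. M)"

text \<open>Sample and ghost sample live on one product space: \<open>\<omega> (i, False)\<close> is the \<open>i\<close>-th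
  observation and \<open>\<omega> (i, True)\<close> its ghost copy.\<close>
abbreviation "W \<equiv> PiM ({..<n} \<times> (UNIV :: bool set)) (\<lambda>_. M)"

definition smp :: "(nat \<times> bool \<Rightarrow> 'z) \<Rightarrow> nat \<Rightarrow> 'z" where
  "smp \<omega> = (\<lambda>i\<in>{..<n}. \<omega> (i, False))"

text \<open>The second index is an exclusive or: observation and ghost change places exactly at the
  indices in \<open>S\<close>.\<close>

definition swp :: "nat set \<Rightarrow> (nat \<times> bool \<Rightarrow> 'z) \<Rightarrow> nat \<times> bool \<Rightarrow> 'z" where
  "swp S \<omega> = (\<lambda>k\<in>{..<n} \<times> UNIV. \<omega> (fst k, snd k \<noteq> (fst k \<in> S)))"

lemma prob_space_Mn: "prob_space Mn"
  by (rule prob_space_PiM) (rule prob_space_axioms)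

lemma prob_space_W: "prob_space W"
  by (rule prob_space_PiM) (rule prob_space_axioms)

lemma measurable_smp [measurable]: "smp \<in> measurable W Mn"
  unfolding smp_def by (rule measurable_restrict) (auto intro: measurable_component_singleton)

lemma measurable_swp [measurable]: "swp S \<in> measurable W W"
  unfolding swp_def by (rule measurable_restrict) (auto intro: measurable_component_singleton)

lemma integral_swp:
  fixes F :: "_ \<Rightarrow> real"
  assumes F: "F \<in> borel_measurable W"
  shows "(\<integral>\<omega>. F (swp S \<omega>) \<partial>W) = (\<integral>\<omega>. F \<omega> \<partial>W)"
proof -
  have "distr W W (swp S) = W"
    unfolding swp_def
    by (rule distr_PiM_reindex[where M = "\<lambda>_. M" and f = "\<lambda>k. (fst k, snd k \<noteq> (fst k \<in> S))"])
      (use prob_space_axioms in \<open>auto simp: inj_on_def\<close>)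
  then show ?thesis using integral_distr[OF measurable_swp F, of S] by metis
qed

lemma integral_smp:
  fixes F :: "_ \<Rightarrow> real"
  assumes F: "F \<in> borel_measurable Mn"
  shows "(\<integral>\<omega>. F (smp \<omega>) \<partial>W) = (\<integral>D. F D \<partial>Mn)"
proof -
  have "distr W Mn smp = Mn"
    unfolding smp_def
    using distr_PiM_reindex[of "{..<n} \<times> UNIV" "\<lambda>_. M" "\<lambda>i. (i, False)" "{..<n}"]
      prob_space_axioms by (auto simp: inj_on_def)
  then show ?thesis using integral_distr[OF measurable_smp F] by metis
qed

text \<open>A ghost observation is a coordinate that the sample does not use, hence independent of
  it. Moving it to an extra index \<open>n\<close> beside \<open>{..<n}\<close> makes Fubini
  applicable.\<close>

lemma integral_ghost:
  fixes \<phi> :: "(nat \<Rightarrow> 'z) \<Rightarrow> 'z \<Rightarrow> real"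
  assumes m: "case_prod \<phi> \<in> borel_measurable (Mn \<Otimes>\<^sub>M M)"
    and b: "\<And>D z. D \<in> space Mn \<Longrightarrow> z \<in> space M \<Longrightarrow> \<bar>\<phi> D z\<bar> \<le> b"
    and i: "i < n"
  shows "(\<integral>\<omega>. \<phi> (smp \<omega>) (\<omega> (i, True)) \<partial>W) = (\<integral>D. (\<integral>z. \<phi> D z \<partial>M) \<partial>Mn)"
proof -
  let ?J = "insert n {..<n}"
  let ?MJ = "PiM ?J (\<lambda>_. M)"
  let ?t = "\<lambda>k. if k = n then (i, True) else (k, False)"
  let ?T = "\<lambda>\<omega>. \<lambda>k\<in>?J. \<omega> (?t k)"
  let ?G = "\<lambda>\<omega>. \<phi> (restrict \<omega> {..<n}) (\<omega> n)"
  interpret J: product_prob_space "\<lambda>_. M" ?J by unfold_locales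
  have MJ: "prob_space ?MJ" by (rule prob_space_PiM) (rule prob_space_axioms)
  have r: "(\<lambda>\<omega>. (restrict \<omega> {..<n}, \<omega> n)) \<in> measurable ?MJ (Mn \<Otimes>\<^sub>M M)"
    by (intro measurable_Pair measurable_restrict_subset measurable_component_singleton) auto
  have G: "?G \<in> borel_measurable ?MJ" using measurable_compose[OF r m] by simp
  have T: "?T \<in> measurable W ?MJ"
    using i by (intro measurable_restrict measurable_component_singleton) auto
  have "distr W ?MJ ?T = ?MJ"
    using distr_PiM_reindex[of "{..<n} \<times> UNIV" "\<lambda>_. M" ?t ?J] prob_space_axioms i
    by (auto simp: inj_on_def)
  then have "(\<integral>\<omega>. ?G (?T \<omega>) \<partial>W) = (\<integral>\<omega>. ?G \<omega> \<partial>?MJ)"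
    using integral_distr[OF T G] by metis
  moreover have "?G (?T \<omega>) = \<phi> (smp \<omega>) (\<omega> (i, True))" for \<omega>
  proof -
    have "restrict (?T \<omega>) {..<n} = smp \<omega>" by (auto simp: smp_def fun_eq_iff)
    then show ?thesis by simp
  qed
  moreover have "(\<integral>\<omega>. ?G \<omega> \<partial>?MJ) = (\<integral>D. (\<integral>z. ?G (D(n := z)) \<partial>M) \<partial>Mn)"
  proof (rule J.product_integral_insert)
    show "integrable ?MJ ?G"
    proof (rule prob_space.integrable_bounded_abs[OF MJ G])
      fix \<omega> assume "\<omega> \<in> space ?MJ"
      then have "(restrict \<omega> {..<n}, \<omega> n) \<in> space (Mn \<Otimes>\<^sub>M M)" using measurable_space[OF r] by blast
      then show "\<bar>?G \<omega>\<bar> \<le> b" by (intro b) (auto simp: space_pair_measure)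
    qed
  qed auto
  moreover have "restrict (D(n := z)) {..<n} = D" if "D \<in> space Mn" for D z
    using that by (auto simp: space_PiM PiE_def extensional_def fun_eq_iff)
  ultimately show ?thesis by (simp cong: Bochner_Integration.integral_cong)
qed

text \<open>Swapping observations with their ghosts preserves \<open>W\<close>; averaging over all swaps before
  integrating means that only the selected hypothesis \<open>A D\<close>, and never a supremum over the class,
  has to be measurable.\<close>
theorem offset_symmetrization:
  fixes q g :: "'c \<Rightarrow> 'z \<Rightarrow> real" and A :: "(nat \<Rightarrow> 'z) \<Rightarrow> 'c"
  assumes A: "\<And>D. D \<in> space Mn \<Longrightarrow> A D \<in> \<C>"
    and mq: "(\<lambda>(D, z). q (A D) z) \<in> borel_measurable (Mn \<Otimes>\<^sub>M M)"
    and mg: "(\<lambda>(D, z). g (A D) z) \<in> borel_measurable (Mn \<Otimes>\<^sub>M M)"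
    and g: "\<And>c z. c \<in> \<C> \<Longrightarrow> z \<in> space M \<Longrightarrow> 0 \<le> g c z" "\<And>c z. c \<in> \<C> \<Longrightarrow> z \<in> space M \<Longrightarrow> g c z \<le> 1"
    and q: "\<And>c z. c \<in> \<C> \<Longrightarrow> z \<in> space M \<Longrightarrow> \<bar>q c z\<bar> \<le> b * g c z"
    and \<kappa>: "0 < \<kappa>" "\<kappa> \<le> b"
    and fin: "\<And>K. finite K \<Longrightarrow> K \<subseteq> space M \<Longrightarrow> finite ((\<lambda>c. restrict (\<lambda>z. (q c z, g c z)) K) ` \<C>)"
    and card: "\<And>K. finite K \<Longrightarrow> K \<subseteq> space M \<Longrightarrow> card K \<le> 2 * n \<Longrightarrow>
        real (card ((\<lambda>c. restrict (\<lambda>z. (q c z, g c z)) K) ` \<C>)) \<le> N"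
  shows "real n * (\<integral>D. (\<integral>z. q (A D) z - \<kappa> * g (A D) z \<partial>M) \<partial>Mn)
      - (\<Sum>i<n. \<integral>D. q (A D) (D i) + \<kappa> * g (A D) (D i) \<partial>Mn) \<le> 2 * b\<^sup>2 / \<kappa> * ln N"
proof -
  interpret W: prob_space W by (rule prob_space_W)
  interpret Mn: prob_space Mn by (rule prob_space_Mn)
  have b0: "b > 0" using \<kappa> by linarith
  \<comment> \<open>This scale makes the sign coefficients at most 1 (through
    \<open>2 * b * lam \<le> 1\<close>) and their squares at most the scaled offsets (through
    \<open>2 * b\<^sup>2 * lam = \<kappa>\<close>).\<close>
  define lam where "lam = \<kappa> / (2 * b\<^sup>2)"
  have lam: "lam > 0" "2 * b * lam \<le> 1" "2 * b\<^sup>2 * lam = \<kappa>"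
    using \<kappa> b0 by (auto simp: lam_def field_simps power2_eq_square)
  have qb: "\<bar>q c z\<bar> \<le> b" if "c \<in> \<C>" "z \<in> space M" for c z
    using q[OF that] g[OF that] b0 by (smt (verit) mult_left_le)
  \<comment> \<open>The offset has opposite signs in \<open>u\<close> and \<open>v\<close>, so in
    ghost term minus sample term it becomes a penalty symmetric in the two observations.\<close>
  define u where "u D z = q (A D) z - \<kappa> * g (A D) z" for D z
  define v where "v D z = q (A D) z + \<kappa> * g (A D) z" for D z
  have mu: "case_prod u \<in> borel_measurable (Mn \<Otimes>\<^sub>M M)" and mv: "case_prod v \<in> borel_measurable (Mn \<Otimes>\<^sub>M M)"
    unfolding u_def v_def using mq mg by (auto simp: case_prod_beta)
  have bnd: "\<bar>u D z\<bar> \<le> b + \<kappa>" "\<bar>v D z\<bar> \<le> b + \<kappa>" if "D \<in> space Mn" "z \<in> space M" for D z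
  proof -
    have "0 \<le> \<kappa> * g (A D) z" "\<kappa> * g (A D) z \<le> \<kappa>"
      using g[OF A[OF that(1)] that(2)] \<kappa> by (auto simp: mult_left_le)
    then show "\<bar>u D z\<bar> \<le> b + \<kappa>" "\<bar>v D z\<bar> \<le> b + \<kappa>"
      using qb[OF A[OF that(1)] that(2)] by (auto simp: u_def v_def)
  qed
  have comp: "\<omega> k \<in> space M" if "\<omega> \<in> space W" "fst k < n" for \<omega> k
    using that by (cases k) (auto simp: space_PiM PiE_iff)
  have smpsp: "smp \<omega> \<in> space Mn" if "\<omega> \<in> space W" for \<omega>
    using that measurable_space[OF measurable_smp] by blast
  have mW: "(\<lambda>\<omega>. h (smp \<omega>) (\<omega> (i, e))) \<in> borel_measurable W"
    if "case_prod h \<in> borel_measurable (Mn \<Otimes>\<^sub>M M)" "i < n" for h i e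
  proof -
    have "(\<lambda>\<omega>. (smp \<omega>, \<omega> (i, e))) \<in> measurable W (Mn \<Otimes>\<^sub>M M)"
      using that(2) by (intro measurable_Pair measurable_component_singleton) auto
    from measurable_compose[OF this that(1)] show ?thesis by simp
  qed
  have iu: "integrable W (\<lambda>\<omega>. u (smp \<omega>) (\<omega> (i, True)))" if "i < n" for i
    using that by (intro W.integrable_bounded_abs[OF mW[OF mu], where b = "b + \<kappa>"] bnd smpsp comp) auto
  have iv: "integrable W (\<lambda>\<omega>. v (smp \<omega>) (\<omega> (i, False)))" if "i < n" for i
    using that by (intro W.integrable_bounded_abs[OF mW[OF mv], where b = "b + \<kappa>"] bnd smpsp comp) auto
  define F where "F \<omega> = (\<Sum>i<n. u (smp \<omega>) (\<omega> (i, True)) - v (smp \<omega>) (\<omega> (i, False)))" for \<omega>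
  have iF: "integrable W F" unfolding F_def using iu iv by auto
  then have mF: "F \<in> borel_measurable W" by auto
  have EF: "(\<integral>\<omega>. F \<omega> \<partial>W) = real n * (\<integral>D. (\<integral>z. u D z \<partial>M) \<partial>Mn) - (\<Sum>i<n. \<integral>D. v D (D i) \<partial>Mn)"
  proof -
    have "(\<integral>\<omega>. F \<omega> \<partial>W) = (\<Sum>i<n. (\<integral>\<omega>. u (smp \<omega>) (\<omega> (i, True)) \<partial>W) - (\<integral>\<omega>. v (smp \<omega>) (\<omega> (i, False)) \<partial>W))"
      unfolding F_def using iu iv by (subst Bochner_Integration.integral_sum) auto
    also have "\<dots> = (\<Sum>i<n. (\<integral>D. (\<integral>z. u D z \<partial>M) \<partial>Mn) - (\<integral>D. v D (D i) \<partial>Mn))"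
    proof (intro sum.cong refl arg_cong2[of _ _ _ _ "(-)"])
      fix i assume "i \<in> {..<n}"
      then have i: "i < n" by simp
      show "(\<integral>\<omega>. u (smp \<omega>) (\<omega> (i, True)) \<partial>W) = (\<integral>D. (\<integral>z. u D z \<partial>M) \<partial>Mn)"
        by (rule integral_ghost[OF mu bnd(1) i])
      have "(\<lambda>D. (D, D i)) \<in> measurable Mn (Mn \<Otimes>\<^sub>M M)"
        using i by (intro measurable_Pair measurable_component_singleton) auto
      from measurable_compose[OF this mv] have "(\<lambda>D. v D (D i)) \<in> borel_measurable Mn" by simp
      from integral_smp[OF this] show "(\<integral>\<omega>. v (smp \<omega>) (\<omega> (i, False)) \<partial>W) = (\<integral>D. v D (D i) \<partial>Mn)"
        using i by (simp add: smp_def)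
    qed
    finally show ?thesis by (simp add: sum_subtractf)
  qed
  \<comment> \<open>For fixed \<open>\<omega>\<close> all swaps share one double sample, so the
    selected hypotheses matter only through their finitely many traces on it.\<close>
  have pt: "(\<Sum>S\<in>Pow {..<n}. F (swp S \<omega>)) \<le> 2 ^ n * ln N / lam" if \<omega>: "\<omega> \<in> space W" for \<omega>
  proof -
    define K where "K = \<omega> ` ({..<n} \<times> UNIV)"
    have K: "finite K" "K \<subseteq> space M" unfolding K_def using comp[OF \<omega>] by auto
    have cK: "card K \<le> 2 * n"
      unfolding K_def by (rule order_trans[OF card_image_le]) (auto simp: card_cartesian_product)
    define \<rho> where "\<rho> c = restrict (\<lambda>z. (q c z, g c z)) K" for c
    define a where "a r i = lam * (fst (r (\<omega> (i, False))) - fst (r (\<omega> (i, True))))"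
      for r :: "'z \<Rightarrow> real \<times> real" and i
    define e where "e r i = lam * \<kappa> * (snd (r (\<omega> (i, False))) + snd (r (\<omega> (i, True))))"
      for r :: "'z \<Rightarrow> real \<times> real" and i
    define sel where "sel S = A (smp (swp S \<omega>))" for S
    have sw: "swp S \<omega> \<in> space W" for S using \<omega> measurable_space[OF measurable_swp] by blast
    have selC: "sel S \<in> \<C>" for S unfolding sel_def by (rule A[OF smpsp[OF sw]])
    have in_K: "\<omega> (i, e) \<in> K" if "i < n" for i e using that by (auto simp: K_def)
    have Feq: "lam * F (swp S \<omega>) =
        (\<Sum>i<n. (if i \<in> S then a (\<rho> (sel S)) i else - a (\<rho> (sel S)) i) - e (\<rho> (sel S)) i)" for S
      unfolding F_def sum_distrib_left
      by (intro sum.cong refl)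
        (auto simp: u_def v_def sel_def[symmetric] a_def e_def \<rho>_def in_K swp_def[of S \<omega>, THEN fun_cong] algebra_simps)
    have ae: "\<bar>a r i\<bar> \<le> 1 \<and> (a r i)\<^sup>2 \<le> e r i" if r: "r \<in> \<rho> ` \<C>" and i: "i < n" for r i
    proof -
      obtain c where c: "c \<in> \<C>" "r = \<rho> c" using r by auto
      let ?z = "\<omega> (i, False)" and ?z' = "\<omega> (i, True)"
      have z: "?z \<in> space M" "?z' \<in> space M" using comp[OF \<omega>] i by auto
      let ?s = "g c ?z + g c ?z'"
      have s: "0 \<le> ?s" "?s \<le> 2" using g[OF c(1) z(1)] g[OF c(1) z(2)] by linarith+
      have a: "\<bar>a r i\<bar> \<le> lam * (b * ?s)"
      proof -
        have "\<bar>q c ?z - q c ?z'\<bar> \<le> b * ?s"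
          using q[OF c(1) z(1)] q[OF c(1) z(2)] by (simp add: algebra_simps)
        moreover have "a r i = lam * (q c ?z - q c ?z')"
          unfolding a_def c(2) \<rho>_def using in_K[OF i] by simp
        ultimately show ?thesis using lam(1) by (simp add: abs_mult)
      qed
      have e: "e r i = lam * \<kappa> * ?s" unfolding e_def c(2) \<rho>_def using in_K[OF i] by simp
      have "lam * (b * ?s) \<le> lam * (b * 2)" using lam(1) b0 s by (intro mult_left_mono) auto
      then have 1: "\<bar>a r i\<bar> \<le> 1" using a lam(2) by (simp add: algebra_simps)
      have "(a r i)\<^sup>2 = \<bar>a r i\<bar>\<^sup>2" by simp
      also have "\<dots> \<le> (lam * (b * ?s))\<^sup>2" by (intro power_mono a) auto
      also have "\<dots> = lam\<^sup>2 * b\<^sup>2 * (?s * ?s)" by (simp add: power_mult_distrib power2_eq_square)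
      \<comment> \<open>Because \<open>?s \<le> 2\<close>, the square is dominated by a linear term:
        this is where the variance is absorbed by the offset.\<close>
      also have "\<dots> \<le> lam\<^sup>2 * b\<^sup>2 * (2 * ?s)" using s by (intro mult_left_mono mult_right_mono) auto
      also have "\<dots> = lam * (2 * b\<^sup>2 * lam) * ?s" by (simp add: power2_eq_square)
      also have "\<dots> = e r i" using lam(3) e by simp
      finally show ?thesis using 1 by simp
    qed
    have "(\<Sum>S\<in>Pow {..<n}. lam * F (swp S \<omega>)) \<le> 2 ^ n * ln N"
      unfolding Feq
    proof (rule sum_signs_offset_le[where V = "\<rho> ` \<C>"])
      show "finite (\<rho> ` \<C>)" unfolding \<rho>_def using fin[OF K] .
      show "real (card (\<rho> ` \<C>)) \<le> N" unfolding \<rho>_def using card[OF K cK] .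
    qed (use selC ae in auto)
    then show ?thesis using lam(1) by (simp add: sum_distrib_left[symmetric] field_simps)
  qed
  have iFS: "integrable W (\<lambda>\<omega>. F (swp S \<omega>))" for S
  proof (rule W.integrable_bounded_abs)
    show "(\<lambda>\<omega>. F (swp S \<omega>)) \<in> borel_measurable W" using measurable_compose[OF measurable_swp mF] .
    fix \<omega> assume "\<omega> \<in> space W"
    then have sw: "swp S \<omega> \<in> space W" using measurable_space[OF measurable_swp] by blast
    have "\<bar>F (swp S \<omega>)\<bar> \<le> (\<Sum>i<n. \<bar>u (smp (swp S \<omega>)) (swp S \<omega> (i, True)) - v (smp (swp S \<omega>)) (swp S \<omega> (i, False))\<bar>)"
      unfolding F_def by (rule sum_abs)
    also have "\<dots> \<le> (\<Sum>i<n. 2 * (b + \<kappa>))"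
    proof (rule sum_mono)
      fix i assume "i \<in> {..<n}"
      then show "\<bar>u (smp (swp S \<omega>)) (swp S \<omega> (i, True)) - v (smp (swp S \<omega>)) (swp S \<omega> (i, False))\<bar> \<le> 2 * (b + \<kappa>)"
        using bnd(1)[OF smpsp[OF sw] comp[OF sw, of "(i, True)"]]
          bnd(2)[OF smpsp[OF sw] comp[OF sw, of "(i, False)"]] by auto
    qed
    finally show "\<bar>F (swp S \<omega>)\<bar> \<le> (\<Sum>i<n. 2 * (b + \<kappa>))" .
  qed
  \<comment> \<open>Every swap has the same expectation of \<open>F\<close>, so the pointwise bound
    on the sum over swaps bounds \<open>2 ^ n\<close> copies of it.\<close>
  have "2 ^ n * (\<integral>\<omega>. F \<omega> \<partial>W) = (\<Sum>S\<in>Pow {..<n}. \<integral>\<omega>. F (swp S \<omega>) \<partial>W)"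
    using integral_swp[OF mF] by (simp add: card_Pow)
  also have "\<dots> = (\<integral>\<omega>. (\<Sum>S\<in>Pow {..<n}. F (swp S \<omega>)) \<partial>W)"
    by (rule Bochner_Integration.integral_sum[symmetric]) (rule iFS)
  also have "\<dots> \<le> 2 ^ n * ln N / lam"
    using pt iFS by (intro W.integral_le_const) (auto intro!: AE_I2)
  also have "\<dots> = 2 ^ n * (ln N / lam)" by simp
  finally have "(\<integral>\<omega>. F \<omega> \<partial>W) \<le> ln N / lam" by (rule mult_left_le_imp_le) simp
  also have "\<dots> = 2 * b\<^sup>2 / \<kappa> * ln N" using \<kappa> b0 by (simp add: lam_def)
  finally show ?thesis unfolding EF by (simp add: u_def[abs_def] v_def[abs_def])
qed

end

subsection \<open>Polytopes, the gap, and conditional means\<close>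

lemma ip_diff_right: "ip d y z - ip d y w = (\<Sum>i<d. y i * (z i - w i))"
  by (simp add: ip_def sum_subtractf[symmetric] algebra_simps)

lemma vnorm_eq_L2_set: "vnorm d z = L2_set z {..<d}"
  by (simp add: vnorm_def ip_def L2_set_def power2_eq_square)

lemma abs_ip_le: "\<bar>ip d y z\<bar> \<le> vnorm d y * vnorm d z"
proof -
  have "\<bar>ip d y z\<bar> \<le> (\<Sum>i<d. \<bar>y i\<bar> * \<bar>z i\<bar>)"
    unfolding ip_def by (rule order_trans[OF sum_abs]) (simp add: abs_mult)
  also have "\<dots> \<le> vnorm d y * vnorm d z" unfolding vnorm_eq_L2_set by (rule L2_set_mult_ineq)
  finally show ?thesis .
qed

lemma abs_coord_le_vnorm: "i < d \<Longrightarrow> \<bar>z i\<bar> \<le> vnorm d z"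
  using member_le_L2_set[of "{..<d}" i "\<lambda>i. \<bar>z i\<bar>"]
  by (simp add: vnorm_eq_L2_set L2_set_def)

lemma vnorm_nonneg: "0 \<le> vnorm d z"
  by (simp add: vnorm_eq_L2_set)

text \<open>An extreme point is determined by its set of active constraints: otherwise the segment
  to another point with the same active set could be prolonged backwards.\<close>
lemma finite_ext_pts:
  assumes "is_Hpoly d Z"
  shows "finite (ext_pts Z)"
proof -
  obtain m :: nat and a b where Z: "Z = {z \<in> vecs d. \<forall>j<m. ip d (a j) z \<le> b j}"
    using assms unfolding is_Hpoly_def by blast
  define act where "act z = {j. j < m \<and> ip d (a j) z = b j}" for z
  have "inj_on act (ext_pts Z)"
  proof (rule inj_onI)
    fix z w assume z: "z \<in> ext_pts Z" and w: "w \<in> ext_pts Z" and eq: "act z = act w"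
    have zZ: "z \<in> Z" and wZ: "w \<in> Z" using z w by (auto simp: ext_pts_def)
    \<comment> \<open>\<open>v t\<close> lies beyond \<open>z\<close> on the line from
      \<open>w\<close> through \<open>z\<close>.\<close>
    define v where "v t = (\<lambda>i. z i - t * (w i - z i))" for t :: real
    have ipv: "ip d (a j) (v t) = ip d (a j) z - t * (ip d (a j) w - ip d (a j) z)" for j t
      by (simp add: ip_def v_def algebra_simps sum_distrib_left sum_subtractf sum.distrib)
    \<comment> \<open>Constraints active at \<open>z\<close> are active at \<open>w\<close> too and
      stay equalities along the line; the others are strict at \<open>z\<close> and survive for
      small \<open>t\<close>.\<close>
    have "eventually (\<lambda>t. \<forall>j\<in>{..<m}. ip d (a j) (v t) \<le> b j) (at_right 0)"
    proof (intro eventually_ball_finite ballI)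
      fix j assume "j \<in> {..<m}"
      then have j: "j < m" by simp
      show "eventually (\<lambda>t. ip d (a j) (v t) \<le> b j) (at_right 0)"
      proof (cases "j \<in> act z")
        case True
        then have "ip d (a j) z = b j" "ip d (a j) w = b j" using eq by (auto simp: act_def)
        then show ?thesis by (simp add: ipv)
      next
        case False
        then have "ip d (a j) z < b j" using zZ j by (auto simp: act_def Z less_le)
        moreover have "((\<lambda>t. ip d (a j) (v t)) \<longlongrightarrow> ip d (a j) z) (at_right 0)"
          unfolding ipv by (auto intro!: tendsto_eq_intros)
        ultimately have "eventually (\<lambda>t. ip d (a j) (v t) < b j) (at_right 0)"
          by (rule order_tendstoD(2)[rotated])
        then show ?thesis by eventually_elim simp
      qed
    qed simp
    moreover have "eventually (\<lambda>t::real. 0 < t) (at_right 0)" by (rule eventually_at_right_less)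
    ultimately have "eventually (\<lambda>t. 0 < t \<and> (\<forall>j\<in>{..<m}. ip d (a j) (v t) \<le> b j)) (at_right 0)"
      by eventually_elim simp
    then obtain t where t: "0 < t" "\<forall>j\<in>{..<m}. ip d (a j) (v t) \<le> b j"
      using eventually_happens[of _ "at_right (0::real)"] by auto
    have vZ: "v t \<in> Z" using t(2) zZ wZ by (auto simp: Z vecs_def v_def)
    \<comment> \<open>The weight on \<open>v t\<close> for which the convex combination of
      \<open>w\<close> and \<open>v t\<close> is \<open>z\<close>.\<close>
    define c where "c = 1 / (1 + t)"
    have c: "0 < c" "c < 1" "c * (1 + t) = 1" using t(1) by (auto simp: c_def field_simps)
    have "z = (\<lambda>i. (1 - c) * w i + c * v t i)"
    proof
      fix i
      have "(1 - c) * w i + c * v t i = w i + (c * (1 + t)) * (z i - w i)"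
        by (simp add: v_def algebra_simps)
      then show "z i = (1 - c) * w i + c * v t i" using c(3) by simp
    qed
    then have wv: "w = v t" using z wZ vZ c(1,2) unfolding ext_pts_def by blast
    show "z = w"
    proof
      fix i
      have "w i = z i - t * (w i - z i)" using fun_cong[OF wv, of i] by (simp add: v_def)
      then have "(1 + t) * (w i - z i) = 0" by (simp add: algebra_simps)
      then show "z i = w i" using t(1) by simp
    qed
  qed
  moreover have "finite (act ` ext_pts Z)"
    by (rule finite_subset[of _ "Pow {..<m}"]) (auto simp: act_def)
  ultimately show ?thesis using finite_imageD by blast
qed

text \<open>Finitely many extreme points make the first infimum in \<open>gap\<close> a minimum,
  attained at a suboptimal extreme point and hence strictly above the optimal value.\<close>

lemma gap_le_of_ext_pt:
  assumes fin: "finite (ext_pts Z)" and z: "z \<in> ext_pts Z" "z \<notin> zstar d Z f x" and w: "w \<in> zstar d Z f x"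
  shows "0 < gap d Z f x" "gap d Z f x \<le> ip d (f x) z - ip d (f x) w"
proof -
  let ?S = "ip d (f x) ` (ext_pts Z - zstar d Z f x)"
  have "z \<in> Z" using z by (auto simp: ext_pts_def)
  then have "zstar d Z f x \<noteq> Z" using z by auto
  moreover have "Inf (ip d (f x) ` Z) = ip d (f x) w"
    by (rule cInf_eq_minimum) (use w in \<open>auto simp: zstar_def\<close>)
  ultimately have gap: "gap d Z f x = Inf ?S - ip d (f x) w" by (simp add: gap_def)
  have S: "finite ?S" "?S \<noteq> {}" using fin z by auto
  have "Inf ?S \<in> ?S" using Min_in[OF S] cInf_eq_Min[OF S] by simp
  moreover have "ip d (f x) w < y" if yS: "y \<in> ?S" for y
  proof -
    obtain e where e: "e \<in> ext_pts Z" "e \<notin> zstar d Z f x" "y = ip d (f x) e" using yS by auto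
    have "e \<in> Z" using e by (auto simp: ext_pts_def)
    then obtain v where "v \<in> Z" "ip d (f x) v < ip d (f x) e" using e(2) by (auto simp: zstar_def not_le)
    then show ?thesis using w e(3) by (auto simp: zstar_def intro: le_less_trans)
  qed
  ultimately show "0 < gap d Z f x" unfolding gap by fastforce
  show "gap d Z f x \<le> ip d (f x) z - ip d (f x) w"
    unfolding gap using Min_le[OF S(1)] cInf_eq_Min[OF S] z by auto
qed

section \<open>Measurability of the gap\<close>

lemma continuous_on_ip_left: "continuous_on UNIV (\<lambda>y. ip d y z)"
  unfolding ip_def by (intro continuous_intros continuous_on_product_coordinates)

lemma borel_measurable_ip [measurable (raw)]:
  assumes "\<And>i. i < d \<Longrightarrow> (\<lambda>x. y x i) \<in> borel_measurable M" "\<And>i. i < d \<Longrightarrow> (\<lambda>x. z x i) \<in> borel_measurable M"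
  shows "(\<lambda>x. ip d (y x) (z x)) \<in> borel_measurable M"
  unfolding ip_def using assms by (intro borel_measurable_sum borel_measurable_times) auto

text \<open>The infimum over the possibly uncountable \<open>Z\<close> is measurable because its
  strict sublevel sets are preimages under \<open>f\<close> of open sets. For the other infimum, the
  space splits into finitely many measurable pieces on which the set of suboptimal extreme points is
  constant.\<close>

lemma borel_measurable_gap:
  fixes f :: "(nat \<Rightarrow> real) \<Rightarrow> nat \<Rightarrow> real"
  assumes fin: "finite (ext_pts Z)" and Z: "Z \<noteq> {}" "\<And>z. z \<in> Z \<Longrightarrow> vnorm d z \<le> B"
    and f [measurable]: "f \<in> borel_measurable borel"
  shows "gap d Z f \<in> borel_measurable borel"
proof -
  let ?m = "\<lambda>x. Inf (ip d (f x) ` Z)"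
  have bdd: "bdd_below (ip d (f x) ` Z)" for x
  proof (rule bdd_belowI)
    fix y assume "y \<in> ip d (f x) ` Z"
    then obtain z where z: "z \<in> Z" "y = ip d (f x) z" by auto
    have "vnorm d (f x) * vnorm d z \<le> vnorm d (f x) * B"
      using Z(2)[OF z(1)] vnorm_nonneg by (intro mult_left_mono)
    then show "- (vnorm d (f x) * B) \<le> y" using abs_ip_le[of d "f x" z] z(2) by linarith
  qed
  have pre: "{x. f x \<in> U} \<in> sets borel" if "open U" for U
    using measurable_sets[OF f, of U] that by (simp add: vimage_def)
  have m [measurable]: "?m \<in> borel_measurable borel"
    unfolding borel_measurable_iff_less
  proof
    fix c
    have "open (\<Union>z\<in>Z. {y. ip d y z < c})"
      by (intro open_UN ballI open_Collect_less continuous_on_ip_left continuous_on_const)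
    then have "{x. f x \<in> (\<Union>z\<in>Z. {y. ip d y z < c})} \<in> sets borel" by (rule pre)
    also have "{x. f x \<in> (\<Union>z\<in>Z. {y. ip d y z < c})} = {x \<in> space borel. ?m x < c}"
      using Z(1) bdd by (auto simp: cInf_less_iff)
    finally show "{x \<in> space borel. ?m x < c} \<in> sets borel" .
  qed
  \<comment> \<open>Optimality becomes a comparison with one measurable function instead of with
    every point of \<open>Z\<close>.\<close>
  have zs: "e \<in> zstar d Z f x \<longleftrightarrow> ip d (f x) e \<le> ?m x" if "e \<in> Z" for e x
    using that Z(1) bdd by (auto simp: zstar_def le_cInf_iff)
  have fi [measurable]: "(\<lambda>x. f x i) \<in> borel_measurable borel" for i
    by (rule measurable_compose[OF f measurable_product_coordinates])
  have Zst [measurable]: "Measurable.pred borel (\<lambda>x. zstar d Z f x \<noteq> Z)"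
  proof -
    have eqZ: "zstar d Z f x = Z \<longleftrightarrow> (\<forall>z\<in>Z. \<forall>w\<in>Z. ip d (f x) z \<le> ip d (f x) w)" for x
      unfolding zstar_def by blast
    have "open (\<Union>z\<in>Z. \<Union>w\<in>Z. {y. ip d y w < ip d y z})"
      by (intro open_UN ballI open_Collect_less continuous_on_ip_left)
    then have "{x. f x \<in> (\<Union>z\<in>Z. \<Union>w\<in>Z. {y. ip d y w < ip d y z})} \<in> sets borel" by (rule pre)
    also have "{x. f x \<in> (\<Union>z\<in>Z. \<Union>w\<in>Z. {y. ip d y w < ip d y z})} = {x. zstar d Z f x \<noteq> Z}"
      using eqZ by (auto simp: not_le[symmetric])
    finally show ?thesis by (simp add: pred_def)
  qed
  have ipm: "(\<lambda>x. ip d (f x) e) \<in> borel_measurable borel" for e by measurable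
  have pe: "Measurable.pred borel (\<lambda>x. (\<not> ip d (f x) e \<le> ?m x) = t)" for e t
    using borel_measurable_le[OF ipm m, of e] borel_measurable_less[OF m ipm, of e]
    by (cases t) (auto simp: pred_def not_le)
  define S where "S x = {e \<in> ext_pts Z. \<not> ip d (f x) e \<le> ?m x}" for x
  have S: "ext_pts Z - zstar d Z f x = S x" for x
    using zs by (auto simp: S_def ext_pts_def)
  have SE: "S x = T \<longleftrightarrow> T \<subseteq> ext_pts Z \<and> (\<forall>e\<in>ext_pts Z. (\<not> ip d (f x) e \<le> ?m x) = (e \<in> T))" for x T
    by (auto simp: S_def)
  have "(\<lambda>x. Inf (ip d (f x) ` S x)) \<in> borel_measurable borel"
  proof (rule measurable_piecewise_restrict[of "(\<lambda>T. {x. S x = T}) ` Pow (ext_pts Z)"])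
    show "countable ((\<lambda>T. {x. S x = T}) ` Pow (ext_pts Z))" using fin by (intro countable_finite) auto
    show "space borel \<subseteq> \<Union> ((\<lambda>T. {x. S x = T}) ` Pow (ext_pts Z))" by (auto simp: S_def)
    fix \<Omega> assume "\<Omega> \<in> (\<lambda>T. {x. S x = T}) ` Pow (ext_pts Z)"
    then obtain T where T: "T \<subseteq> ext_pts Z" "\<Omega> = {x. S x = T}" by auto
    have finT: "finite T" using T fin finite_subset by blast
    have "Measurable.pred borel (\<lambda>x. \<forall>e\<in>ext_pts Z. (\<not> ip d (f x) e \<le> ?m x) = (e \<in> T))"
      using fin pe by (intro pred_intros_finite) auto
    then show "\<Omega> \<inter> space borel \<in> sets borel" unfolding T(2) SE using T(1) by (simp add: pred_def)
    have "(\<lambda>x. Inf (ip d (f x) ` T)) \<in> borel_measurable borel"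
      using finT ipm by (intro borel_measurable_cINF_real) (auto intro: countable_finite)
    then have "(\<lambda>x. Inf (ip d (f x) ` T)) \<in> borel_measurable (restrict_space borel \<Omega>)"
      by (rule measurable_restrict_space1)
    then show "(\<lambda>x. Inf (ip d (f x) ` S x)) \<in> borel_measurable (restrict_space borel \<Omega>)"
      by (rule measurable_cong[THEN iffD1, rotated]) (auto simp: T(2) space_restrict_space)
  qed
  then have [measurable]: "(\<lambda>x. Inf (ip d (f x) ` (ext_pts Z - zstar d Z f x))) \<in> borel_measurable borel"
    unfolding S .
  show ?thesis unfolding gap_def by measurable
qed

lemma borel_vecs [measurable]: "vecs k \<in> sets borel"
proof -
  have "Measurable.pred borel (\<lambda>z :: nat \<Rightarrow> real. \<forall>i. i \<ge> k \<longrightarrow> z i = 0)"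
    by measurable
  then show ?thesis by (simp add: vecs_def pred_def)
qed

text \<open>Testing against indicators identifies \<open>\<phi> (fst z)\<close> as the conditional
  expectation of \<open>snd z i\<close> given \<open>fst z\<close>; a bounded factor that depends on
  \<open>fst z\<close> alone can then be pulled out.\<close>

lemma integral_cond_mean:
  fixes P :: "((nat \<Rightarrow> real) \<times> (nat \<Rightarrow> real)) measure" and \<phi> u :: "(nat \<Rightarrow> real) \<Rightarrow> real"
  assumes P: "prob_space P" and setsP: "sets P = sets (borel \<Otimes>\<^sub>M borel)"
    and Y: "AE z in P. \<bar>snd z i\<bar> \<le> c"
    and \<phi> [measurable]: "\<phi> \<in> borel_measurable borel" and int: "integrable (distr P borel fst) \<phi>"
    and cond: "\<And>A. A \<in> sets borel \<Longrightarrow>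
      (\<integral>z. indicator A (fst z) * snd z i \<partial>P) = (\<integral>x. indicator A x * \<phi> x \<partial>distr P borel fst)"
    and u [measurable]: "u \<in> borel_measurable borel" and ub: "\<And>x. \<bar>u x\<bar> \<le> k"
  shows "integrable P (\<lambda>z. u (fst z) * snd z i)"
    and "integrable (distr P borel fst) (\<lambda>x. u x * \<phi> x)"
    and "(\<integral>z. u (fst z) * snd z i \<partial>P) = (\<integral>x. u x * \<phi> x \<partial>distr P borel fst)"
proof -
  interpret prob_space P by (rule P)
  have fst [measurable]: "fst \<in> measurable P borel" and snd [measurable]: "snd \<in> measurable P borel"
    by (auto simp: measurable_cong_sets[OF setsP refl])
  have Yi [measurable]: "(\<lambda>z. snd z i) \<in> borel_measurable P"
    by (rule measurable_compose[OF snd measurable_product_coordinates])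
  have iY: "integrable P (\<lambda>z. snd z i)" using Y by (intro integrable_const_bound[of _ c]) auto
  have ku: "\<bar>u x\<bar> \<le> \<bar>k\<bar>" for x using ub[of x] by linarith
  show iuY: "integrable P (\<lambda>z. u (fst z) * snd z i)"
    by (rule Bochner_Integration.integrable_bound[OF integrable_mult_right[OF iY, of k]])
      (use ku in \<open>auto simp: abs_mult intro!: AE_I2 mult_right_mono\<close>)
  show iu\<phi>: "integrable (distr P borel fst) (\<lambda>x. u x * \<phi> x)"
    by (rule Bochner_Integration.integrable_bound[OF integrable_mult_right[OF int, of k]])
      (use ku in \<open>auto simp: abs_mult intro!: AE_I2 mult_right_mono\<close>)
  define F where "F = vimage_algebra (space P) fst (borel :: (nat \<Rightarrow> real) measure)"
  have sub: "subalgebra P F"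
    unfolding subalgebra_def F_def using fst by (auto simp: measurable_iff_sets)
  interpret finite_measure_subalgebra P F using sub by unfold_locales
  have fstF: "fst \<in> measurable F borel" unfolding F_def by (rule measurable_vimage_algebra1) auto
  have i\<phi>: "integrable P (\<lambda>z. \<phi> (fst z))" using integrable_distr[OF fst int] .
  have "AE z in P. real_cond_exp P F (\<lambda>z. snd z i) z = \<phi> (fst z)"
  proof (rule real_cond_exp_charact[OF _ iY i\<phi>])
    show "(\<lambda>z. \<phi> (fst z)) \<in> borel_measurable F" by (rule measurable_compose[OF fstF \<phi>])
    fix A assume "A \<in> sets F"
    then obtain A' where A': "A' \<in> sets borel" "A = fst -` A' \<inter> space P"
      unfolding F_def by (subst (asm) sets_vimage_algebra2) auto
    have "(\<integral>z\<in>A. snd z i \<partial>P) = (\<integral>z. indicator A' (fst z) * snd z i \<partial>P)"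
      unfolding set_lebesgue_integral_def A'(2)
      by (intro Bochner_Integration.integral_cong) (auto simp: indicator_def)
    also have "\<dots> = (\<integral>z. indicator A' (fst z) * \<phi> (fst z) \<partial>P)"
      unfolding cond[OF A'(1)] using A'(1) by (intro integral_distr) auto
    also have "\<dots> = (\<integral>z\<in>A. \<phi> (fst z) \<partial>P)"
      unfolding set_lebesgue_integral_def A'(2)
      by (intro Bochner_Integration.integral_cong) (auto simp: indicator_def)
    finally show "(\<integral>z\<in>A. snd z i \<partial>P) = (\<integral>z\<in>A. \<phi> (fst z) \<partial>P)" .
  qed
  then have "(\<integral>z. u (fst z) * real_cond_exp P F (\<lambda>z. snd z i) z \<partial>P) = (\<integral>z. u (fst z) * \<phi> (fst z) \<partial>P)"
    by (intro integral_cong_AE) auto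
  also have "\<dots> = (\<integral>x. u x * \<phi> x \<partial>distr P borel fst)" by (subst integral_distr) auto
  finally show "(\<integral>z. u (fst z) * snd z i \<partial>P) = (\<integral>x. u x * \<phi> x \<partial>distr P borel fst)"
    using real_cond_exp_intg(2)[OF iuY measurable_compose[OF fstF u] Yi] by simp
qed

subsection \<open>Risk of the empirical minimiser\<close>

lemma rpow_mult_pos:
  assumes "0 \<le> s" "0 < t"
  shows "rpow (s * t) a = rpow s a * t powr a"
  using assms by (simp add: rpow_def powr_mult)

lemma rpow_nonneg: "0 \<le> rpow s a"
  by (simp add: rpow_def)

locale policy_learning = ghost_sample P n
  for P :: "((nat \<Rightarrow> real) \<times> (nat \<Rightarrow> real)) measure" and n :: nat +
  fixes p d \<eta> :: nat and \<alpha> \<gamma> B :: real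
    and f pistar :: "(nat \<Rightarrow> real) \<Rightarrow> nat \<Rightarrow> real"
    and Z :: "(nat \<Rightarrow> real) set" and Pol :: "((nat \<Rightarrow> real) \<Rightarrow> nat \<Rightarrow> real) set"
    and erm :: "(nat \<Rightarrow> (nat \<Rightarrow> real) \<times> (nat \<Rightarrow> real)) \<Rightarrow> (nat \<Rightarrow> real) \<Rightarrow> nat \<Rightarrow> real"
  assumes \<gamma>0: "0 \<le> \<gamma>"
    and sets_P: "sets P = sets (borel \<Otimes>\<^sub>M borel)"
    and AE_P: "AE z in P. fst z \<in> vecs p \<and> snd z \<in> vecs d \<and> vnorm d (snd z) \<le> 1"
    and f_vecs: "\<And>x. f x \<in> vecs d"
    and f_meas: "\<And>i. i < d \<Longrightarrow> (\<lambda>x. f x i) \<in> borel_measurable borel"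
    and f_int: "\<And>i. i < d \<Longrightarrow> integrable (distr P borel fst) (\<lambda>x. f x i)"
    and f_cond: "\<And>i A. i < d \<Longrightarrow> A \<in> sets borel \<Longrightarrow>
        (\<integral>z. indicator A (fst z) * snd z i \<partial>P) = (\<integral>x. indicator A x * f x i \<partial>distr P borel fst)"
    and Z_poly: "is_Hpoly d Z" and Z_bound: "\<And>z. z \<in> Z \<Longrightarrow> vnorm d z \<le> B"
    and noise: "\<And>\<delta>. 0 < \<delta> \<Longrightarrow>
        measure (distr P borel fst) {x. 0 < gap d Z f x \<and> gap d Z f x \<le> \<delta>} \<le> rpow (\<gamma> * \<delta> / B) \<alpha>"
    and unique: "AE x in distr P borel fst. \<forall>z\<in>zstar d Z f x. \<forall>w\<in>zstar d Z f x. z = w"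
    and Pol_ext: "\<And>\<pi> x. \<pi> \<in> Pol \<Longrightarrow> x \<in> vecs p \<Longrightarrow> \<pi> x \<in> ext_pts Z"
    and Pol_dim: "natarajan_dim (vecs p) Pol \<le> enat \<eta>"
    and pistar_opt: "\<And>x. x \<in> vecs p \<Longrightarrow> pistar x \<in> zstar d Z f x"
    and pistar_Pol: "pistar \<in> Pol"
    and n1: "1 \<le> n"
    and erm_Pol: "\<And>D. D \<in> space Mn \<Longrightarrow> (\<And>i. i < n \<Longrightarrow> fst (D i) \<in> vecs p) \<Longrightarrow> erm D \<in> Pol"
    and erm_min: "\<And>D \<pi>. D \<in> space Mn \<Longrightarrow> (\<And>i. i < n \<Longrightarrow> fst (D i) \<in> vecs p) \<Longrightarrow> \<pi> \<in> Pol \<Longrightarrow>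
        (\<Sum>i<n. ip d (snd (D i)) (erm D (fst (D i)))) \<le> (\<Sum>i<n. ip d (snd (D i)) (\<pi> (fst (D i))))"
    and erm_meas: "\<And>i. i < d \<Longrightarrow> (\<lambda>(D, x). erm D x i) \<in> borel_measurable (Mn \<Otimes>\<^sub>M borel)"
    and pistar_meas: "\<And>i. i < d \<Longrightarrow> (\<lambda>x. pistar x i) \<in> borel_measurable borel"
begin

section \<open>Excess loss and disagreement of a policy\<close>

abbreviation "PX \<equiv> distr P borel fst"

definition good :: "((nat \<Rightarrow> real) \<times> (nat \<Rightarrow> real)) set" where
  "good = {z. fst z \<in> vecs p \<and> snd z \<in> vecs d \<and> vnorm d (snd z) \<le> 1}"

text \<open>Excess loss and disagreement with \<open>pistar\<close>, set to \<open>0\<close> on the null set where the data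
  assumptions fail, so that all bounds hold everywhere.\<close>
definition loss :: "((nat \<Rightarrow> real) \<Rightarrow> nat \<Rightarrow> real) \<Rightarrow> (nat \<Rightarrow> real) \<times> (nat \<Rightarrow> real) \<Rightarrow> real" where
  "loss \<pi> z = (if z \<in> good then ip d (snd z) (\<pi> (fst z)) - ip d (snd z) (pistar (fst z)) else 0)"

definition dis :: "((nat \<Rightarrow> real) \<Rightarrow> nat \<Rightarrow> real) \<Rightarrow> (nat \<Rightarrow> real) \<times> (nat \<Rightarrow> real) \<Rightarrow> real" where
  "dis \<pi> z = (if z \<in> good \<and> (\<exists>i<d. \<pi> (fst z) i \<noteq> pistar (fst z) i) then 1 else 0)"

text \<open>Nothing places \<open>erm D\<close> in \<open>Pol\<close> when a covariate of
  \<open>D\<close> lies outside \<open>vecs p\<close>; falling back on \<open>pistar\<close> there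
  puts \<open>alg D\<close> in \<open>Pol\<close> for every \<open>D\<close> in the sample
  space.\<close>

definition alg :: "(nat \<Rightarrow> (nat \<Rightarrow> real) \<times> (nat \<Rightarrow> real)) \<Rightarrow> (nat \<Rightarrow> real) \<Rightarrow> nat \<Rightarrow> real" where
  "alg D = (if \<forall>i<n. fst (D i) \<in> vecs p then erm D else pistar)"

lemma fst_meas [measurable]: "fst \<in> measurable P borel"
  and snd_meas [measurable]: "snd \<in> measurable P borel"
  by (auto simp: measurable_cong_sets[OF sets_P refl])

lemma snd_coord_meas [measurable]: "(\<lambda>z. snd z i) \<in> borel_measurable P"
  by (rule measurable_compose[OF snd_meas measurable_product_coordinates])

lemma good_pred [measurable]: "Measurable.pred P (\<lambda>z. z \<in> good)"
  unfolding good_def vnorm_def mem_Collect_eq by measurable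

lemma AE_good: "AE z in P. z \<in> good"
  using AE_P by (simp add: good_def)

lemma prob_space_PX: "prob_space PX"
  by (rule prob_space_distr) measurable

lemma AE_PX_vecs: "AE x in PX. x \<in> vecs p"
proof -
  have "AE z in P. fst z \<in> vecs p" using AE_P by eventually_elim simp
  then show ?thesis by (subst AE_distr_iff) auto
qed

lemma fin_ext: "finite (ext_pts Z)"
  by (rule finite_ext_pts[OF Z_poly])

lemma Pol_Z: "\<pi> \<in> Pol \<Longrightarrow> x \<in> vecs p \<Longrightarrow> \<pi> x \<in> Z"
  using Pol_ext by (auto simp: ext_pts_def)

lemma zero_vecs: "(\<lambda>_. 0) \<in> vecs p"
  by (simp add: vecs_def)

lemma Z_nonempty: "Z \<noteq> {}"
  using Pol_Z[OF pistar_Pol zero_vecs] by auto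

lemma B_nonneg: "0 \<le> B"
  using Z_bound[OF Pol_Z[OF pistar_Pol zero_vecs]] vnorm_nonneg order_trans by blast

lemma f_meas_vec: "f \<in> borel_measurable borel"
proof (rule measurable_coordinatewise_then_product)
  fix i
  show "(\<lambda>x. f x i) \<in> borel_measurable borel"
    using f_meas[of i] f_vecs by (cases "i < d") (auto simp: vecs_def)
qed

lemma abs_ip_le_B: "z \<in> good \<Longrightarrow> w \<in> Z \<Longrightarrow> \<bar>ip d (snd z) w\<bar> \<le> B"
proof -
  assume z: "z \<in> good" and w: "w \<in> Z"
  have "\<bar>ip d (snd z) w\<bar> \<le> vnorm d (snd z) * vnorm d w" by (rule abs_ip_le)
  also have "\<dots> \<le> 1 * B" using z Z_bound[OF w] vnorm_nonneg B_nonneg by (intro mult_mono) (auto simp: good_def)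
  finally show ?thesis by simp
qed

text \<open>Agreement gives zero excess loss, and disagreement involves two losses of size at most
  \<open>B\<close>. The factor \<open>dis\<close> is what lets the offset control the
  variance.\<close>

lemma abs_loss_le: "\<pi> \<in> Pol \<Longrightarrow> \<bar>loss \<pi> z\<bar> \<le> 2 * B * dis \<pi> z"
proof -
  assume \<pi>: "\<pi> \<in> Pol"
  show ?thesis
  proof (cases "z \<in> good")
    case True
    then have x: "fst z \<in> vecs p" by (simp add: good_def)
    show ?thesis
    proof (cases "\<exists>i<d. \<pi> (fst z) i \<noteq> pistar (fst z) i")
      case t: True
      have "\<bar>ip d (snd z) (\<pi> (fst z))\<bar> \<le> B" "\<bar>ip d (snd z) (pistar (fst z))\<bar> \<le> B"
        using abs_ip_le_B[OF True] Pol_Z \<pi> pistar_Pol x by auto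
      then show ?thesis using True t by (simp add: loss_def dis_def)
    next
      case False
      then show ?thesis using True by (auto simp: loss_def dis_def ip_diff_right)
    qed
  qed (simp add: loss_def dis_def)
qed

lemma dis_bounds: "0 \<le> dis \<pi> z" "dis \<pi> z \<le> 1"
  by (auto simp: dis_def)

lemma abs_loss_le': "\<pi> \<in> Pol \<Longrightarrow> \<bar>loss \<pi> z\<bar> \<le> 2 * B"
  using abs_loss_le[of \<pi> z] dis_bounds[of \<pi> z] B_nonneg mult_left_le[of "dis \<pi> z" "2 * B"] by linarith

lemma loss_cong: "(z \<in> good \<Longrightarrow> \<pi> (fst z) = \<pi>' (fst z)) \<Longrightarrow> loss \<pi> z = loss \<pi>' z"
  by (simp add: loss_def)

lemma dis_cong: "(z \<in> good \<Longrightarrow> \<pi> (fst z) = \<pi>' (fst z)) \<Longrightarrow> dis \<pi> z = dis \<pi>' z"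
  by (auto simp: dis_def)

text \<open>The abstract parameter space \<open>N\<close> serves both the data-dependent policy
  \<open>alg\<close> and, with a one-point \<open>N\<close>, a fixed policy.\<close>

lemma loss_dis_measurable:
  assumes "\<And>i. i < d \<Longrightarrow> (\<lambda>(D, z). Q D (fst z) i) \<in> borel_measurable (N \<Otimes>\<^sub>M P)"
  shows "(\<lambda>(D, z). loss (Q D) z) \<in> borel_measurable (N \<Otimes>\<^sub>M P)"
    and "(\<lambda>(D, z). dis (Q D) z) \<in> borel_measurable (N \<Otimes>\<^sub>M P)"
proof -
  have a [measurable]: "(\<lambda>w. Q (fst w) (fst (snd w)) i) \<in> borel_measurable (N \<Otimes>\<^sub>M P)" if "i < d" for i
    using assms[OF that] by (simp add: case_prod_beta)
  have b [measurable]: "(\<lambda>w. pistar (fst (snd w)) i) \<in> borel_measurable (N \<Otimes>\<^sub>M P)" if "i < d" for i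
    using measurable_compose[OF measurable_compose[OF measurable_snd fst_meas] pistar_meas[OF that]] .
  have c [measurable]: "(\<lambda>w. snd (snd w) i) \<in> borel_measurable (N \<Otimes>\<^sub>M P)" for i
    using measurable_compose[OF measurable_snd snd_coord_meas] .
  have g [measurable]: "Measurable.pred (N \<Otimes>\<^sub>M P) (\<lambda>w. snd w \<in> good)"
    using measurable_compose[OF measurable_snd good_pred] .
  show "(\<lambda>(D, z). loss (Q D) z) \<in> borel_measurable (N \<Otimes>\<^sub>M P)"
    unfolding loss_def case_prod_beta
    by (intro measurable_If borel_measurable_diff borel_measurable_ip a b c borel_measurable_const g[unfolded pred_def])
  have ex: "Measurable.pred (N \<Otimes>\<^sub>M P) (\<lambda>w. \<exists>i\<in>{..<d}. Q (fst w) (fst (snd w)) i \<noteq> pistar (fst (snd w)) i)"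
    by (intro pred_intros_finite) (auto intro!: pred_intros_logic a b simp: pred_def)
  show "(\<lambda>(D, z). dis (Q D) z) \<in> borel_measurable (N \<Otimes>\<^sub>M P)"
    unfolding dis_def case_prod_beta using ex g by (auto simp: lessThan_def Bex_def)
qed

lemma alg_Pol: "D \<in> space Mn \<Longrightarrow> alg D \<in> Pol"
  using erm_Pol[of D] pistar_Pol by (auto simp: alg_def)

lemma alg_meas: "i < d \<Longrightarrow> (\<lambda>(D, x). alg D x i) \<in> borel_measurable (Mn \<Otimes>\<^sub>M borel)"
proof -
  assume i: "i < d"
  have e: "(\<lambda>w. erm (fst w) (snd w) i) \<in> borel_measurable (Mn \<Otimes>\<^sub>M borel)"
    using erm_meas[OF i] by (simp add: case_prod_beta)
  have s: "(\<lambda>w. pistar (snd w) i) \<in> borel_measurable (Mn \<Otimes>\<^sub>M borel)"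
    using measurable_compose[OF measurable_snd pistar_meas[OF i]] .
  have c: "Measurable.pred (Mn \<Otimes>\<^sub>M borel) (\<lambda>w. \<forall>k\<in>{..<n}. fst (fst w k) \<in> vecs p)"
  proof (intro pred_intros_finite)
    fix k assume "k \<in> {..<n}"
    then have "(\<lambda>D. D k) \<in> measurable Mn P" by (intro measurable_component_singleton) auto
    then have "(\<lambda>w. fst w k) \<in> measurable (Mn \<Otimes>\<^sub>M borel) P"
      by (rule measurable_compose[OF measurable_fst])
    then have "(\<lambda>w. fst (fst w k)) \<in> measurable (Mn \<Otimes>\<^sub>M borel) borel"
      by (rule measurable_compose[OF _ fst_meas])
    from measurable_compose[OF this, of "\<lambda>x. x \<in> vecs p" "count_space UNIV"]
    show "Measurable.pred (Mn \<Otimes>\<^sub>M borel) (\<lambda>w. fst (fst w k) \<in> vecs p)" by simp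
  qed simp
  have "(\<lambda>w. if \<forall>k\<in>{..<n}. fst (fst w k) \<in> vecs p then erm (fst w) (snd w) i else pistar (snd w) i)
      \<in> borel_measurable (Mn \<Otimes>\<^sub>M borel)"
    using c by (intro measurable_If e s) (simp add: pred_def)
  then show ?thesis
    by (rule measurable_cong[THEN iffD1, rotated]) (auto simp: alg_def case_prod_beta)
qed

lemma alg_meas_P: "i < d \<Longrightarrow> (\<lambda>(D, z). alg D (fst z) i) \<in> borel_measurable (Mn \<Otimes>\<^sub>M P)"
proof -
  assume i: "i < d"
  have "(\<lambda>w. (fst w, fst (snd w))) \<in> measurable (Mn \<Otimes>\<^sub>M P) (Mn \<Otimes>\<^sub>M borel)" by measurable
  from measurable_compose[OF this alg_meas[OF i]] show ?thesis by (simp add: case_prod_beta)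
qed

lemmas alg_loss_meas = loss_dis_measurable(1)[where Q = alg, OF alg_meas_P]
  and alg_dis_meas = loss_dis_measurable(2)[where Q = alg, OF alg_meas_P]

lemma alg_coord_meas: "D \<in> space Mn \<Longrightarrow> i < d \<Longrightarrow> (\<lambda>x. alg D x i) \<in> borel_measurable borel"
  using measurable_compose[OF measurable_Pair1' alg_meas, of D i] by simp

section \<open>Population risk and the noise condition\<close>

definition risk where "risk \<pi> = (\<integral>z. loss \<pi> z \<partial>P)"
definition disp where "disp \<pi> = (\<integral>z. dis \<pi> z \<partial>P)"

lemma single_measurable:
  assumes "\<And>i. i < d \<Longrightarrow> (\<lambda>x. \<pi> x i) \<in> borel_measurable borel"
  shows "loss \<pi> \<in> borel_measurable P" "dis \<pi> \<in> borel_measurable P"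
proof -
  have "(\<lambda>(D, z). \<pi> (fst z) i) \<in> borel_measurable (count_space (UNIV :: unit set) \<Otimes>\<^sub>M P)" if "i < d" for i
    unfolding case_prod_beta using measurable_compose[OF measurable_compose[OF measurable_snd fst_meas] assms[OF that]] .
  note m = loss_dis_measurable[where Q = "\<lambda>_. \<pi>", OF this]
  show "loss \<pi> \<in> borel_measurable P" "dis \<pi> \<in> borel_measurable P"
    using measurable_compose[OF measurable_Pair1' m(1), of "()"] measurable_compose[OF measurable_Pair1' m(2), of "()"]
    by simp_all
qed

text \<open>Policies depend on the covariate alone, so \<open>snd z\<close> may be replaced by its
  conditional mean \<open>f\<close>, coordinate by coordinate.\<close>

lemma risk_eq:
  assumes \<pi>: "\<pi> \<in> Pol" and m: "\<And>i. i < d \<Longrightarrow> (\<lambda>x. \<pi> x i) \<in> borel_measurable borel"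
  shows "integrable PX (\<lambda>x. ip d (f x) (\<pi> x) - ip d (f x) (pistar x))"
    and "risk \<pi> = (\<integral>x. ip d (f x) (\<pi> x) - ip d (f x) (pistar x) \<partial>PX)"
proof -
  \<comment> \<open>The cut-off outside \<open>vecs p\<close>, where the values of policies are
    unconstrained, keeps \<open>u\<close> bounded everywhere.\<close>
  define u where "u i x = (if x \<in> vecs p then \<pi> x i - pistar x i else 0)" for i x
  have um: "u i \<in> borel_measurable borel" if "i < d" for i
    unfolding u_def using m[OF that] pistar_meas[OF that] by measurable
  have ub: "\<bar>u i x\<bar> \<le> 2 * B" if i: "i < d" for i x
  proof (cases "x \<in> vecs p")
    case True
    have "\<bar>\<pi> x i\<bar> \<le> B" "\<bar>pistar x i\<bar> \<le> B"
      using abs_coord_le_vnorm[OF i] Z_bound Pol_Z[OF _ True] \<pi> pistar_Pol order_trans by blast+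
    then show ?thesis using True by (simp add: u_def)
  qed (use B_nonneg in \<open>simp add: u_def\<close>)
  have Y: "AE z in P. \<bar>snd z i\<bar> \<le> 1" if i: "i < d" for i
    using AE_P by eventually_elim (use abs_coord_le_vnorm[OF i] order_trans in blast)
  have C: "integrable P (\<lambda>z. u i (fst z) * snd z i)" "integrable PX (\<lambda>x. u i x * f x i)"
    "(\<integral>z. u i (fst z) * snd z i \<partial>P) = (\<integral>x. u i x * f x i \<partial>PX)" if i: "i < d" for i
    using integral_cond_mean[OF prob_space_axioms sets_P Y[OF i] f_meas[OF i] f_int[OF i] f_cond[OF i] um[OF i] ub[OF i]]
    by auto
  have int: "integrable PX (\<lambda>x. \<Sum>i<d. u i x * f x i)" by (intro Bochner_Integration.integrable_sum C(2)) auto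
  have AEx: "AE x in PX. (\<Sum>i<d. u i x * f x i) = ip d (f x) (\<pi> x) - ip d (f x) (pistar x)"
    using AE_PX_vecs by eventually_elim (simp add: u_def ip_diff_right mult.commute)
  have mx: "(\<lambda>x. ip d (f x) (\<pi> x) - ip d (f x) (pistar x)) \<in> borel_measurable PX"
    using m f_meas pistar_meas by (intro borel_measurable_diff borel_measurable_ip) auto
  show "integrable PX (\<lambda>x. ip d (f x) (\<pi> x) - ip d (f x) (pistar x))"
    using int AEx mx by (subst integrable_cong_AE[symmetric]) auto
  have "risk \<pi> = (\<integral>z. (\<Sum>i<d. u i (fst z) * snd z i) \<partial>P)"
    unfolding risk_def
  proof (rule integral_cong_AE)
    show "AE z in P. loss \<pi> z = (\<Sum>i<d. u i (fst z) * snd z i)"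
      using AE_good by eventually_elim (auto simp: loss_def good_def u_def ip_diff_right mult.commute)
    show "loss \<pi> \<in> borel_measurable P" by (rule single_measurable[OF m])
    show "(\<lambda>z. \<Sum>i<d. u i (fst z) * snd z i) \<in> borel_measurable P"
      using um by (intro borel_measurable_sum borel_measurable_times measurable_compose[OF fst_meas] snd_coord_meas) auto
  qed
  also have "\<dots> = (\<Sum>i<d. \<integral>z. u i (fst z) * snd z i \<partial>P)"
    by (intro Bochner_Integration.integral_sum C(1)) auto
  also have "\<dots> = (\<Sum>i<d. \<integral>x. u i x * f x i \<partial>PX)"
    by (intro sum.cong refl C(3)) auto
  also have "\<dots> = (\<integral>x. (\<Sum>i<d. u i x * f x i) \<partial>PX)"
    by (intro Bochner_Integration.integral_sum[symmetric] C(2)) auto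
  also have "\<dots> = (\<integral>x. ip d (f x) (\<pi> x) - ip d (f x) (pistar x) \<partial>PX)"
    using int mx AEx by (intro integral_cong_AE) auto
  finally show "risk \<pi> = (\<integral>x. ip d (f x) (\<pi> x) - ip d (f x) (pistar x) \<partial>PX)" .
qed

text \<open>Where the optimum is unique, a disagreement costs at least the gap, which exceeds
  \<open>\<epsilon> * B\<close> outside an event controlled by the noise condition.\<close>

lemma margin:
  assumes \<pi>: "\<pi> \<in> Pol" and m: "\<And>i. i < d \<Longrightarrow> (\<lambda>x. \<pi> x i) \<in> borel_measurable borel"
    and B: "0 < B" and \<epsilon>: "0 < \<epsilon>"
  shows "\<epsilon> * B * disp \<pi> - rpow \<gamma> \<alpha> * B * \<epsilon> powr (1 + \<alpha>) \<le> risk \<pi>"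
proof -
  interpret PX: prob_space PX by (rule prob_space_PX)
  let ?N = "{x. \<exists>i\<in>{..<d}. \<pi> x i \<noteq> pistar x i}"
  let ?G = "{x. 0 < gap d Z f x \<and> gap d Z f x \<le> \<epsilon> * B}"
  have N: "?N \<in> sets borel"
  proof -
    have "Measurable.pred borel (\<lambda>x. \<exists>i\<in>{..<d}. \<pi> x i \<noteq> pistar x i)"
      by (intro pred_intros_finite) (use borel_measurable_neq[OF m pistar_meas] in \<open>auto simp: pred_def\<close>)
    then show ?thesis by (simp add: pred_def)
  qed
  have G: "?G \<in> sets borel"
  proof -
    have [measurable]: "gap d Z f \<in> borel_measurable borel"
      by (rule borel_measurable_gap[OF fin_ext Z_nonempty Z_bound f_meas_vec])
    have "Measurable.pred borel (\<lambda>x. 0 < gap d Z f x \<and> gap d Z f x \<le> \<epsilon> * B)" by measurable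
    then show ?thesis by (simp add: pred_def)
  qed
  have disp: "disp \<pi> = (\<integral>x. indicator ?N x \<partial>PX)"
  proof -
    have "disp \<pi> = (\<integral>z. indicator ?N (fst z) \<partial>P)"
      unfolding disp_def
    proof (rule integral_cong_AE)
      show "AE z in P. dis \<pi> z = indicator ?N (fst z)"
        using AE_good by eventually_elim (auto simp: dis_def indicator_def)
      show "(\<lambda>z. indicator ?N (fst z) :: real) \<in> borel_measurable P" using N by measurable
    qed (rule single_measurable[OF m])
    also have "\<dots> = (\<integral>x. indicator ?N x \<partial>PX)" by (rule integral_distr[symmetric]) (use N in auto)
    finally show ?thesis .
  qed
  have iN: "integrable PX (indicator ?N :: _ \<Rightarrow> real)" and iG: "integrable PX (indicator ?G :: _ \<Rightarrow> real)"
    using N G PX.emeasure_finite by (auto simp: less_top[symmetric])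
  have re: "risk \<pi> = (\<integral>x. ip d (f x) (\<pi> x) - ip d (f x) (pistar x) \<partial>PX)"
    by (rule risk_eq(2)[OF \<pi> m])
  have "(\<integral>x. \<epsilon> * B * (indicator ?N x - indicator ?G x) \<partial>PX) \<le> risk \<pi>"
    unfolding re
  proof (rule integral_mono_AE)
    show "integrable PX (\<lambda>x. \<epsilon> * B * (indicator ?N x - indicator ?G x))" using iN iG by auto
    show "integrable PX (\<lambda>x. ip d (f x) (\<pi> x) - ip d (f x) (pistar x))" by (rule risk_eq(1)[OF \<pi> m])
    \<comment> \<open>The left side is at most 0 off \<open>?N\<close>, vanishes on
      \<open>?N\<close> inside \<open>?G\<close>, and equals \<open>\<epsilon> * B\<close>, less
      than the gap, on \<open>?N\<close> outside \<open>?G\<close>.\<close>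
    show "AE x in PX. \<epsilon> * B * (indicator ?N x - indicator ?G x) \<le> ip d (f x) (\<pi> x) - ip d (f x) (pistar x)"
      using AE_PX_vecs unique
    proof eventually_elim
      case (elim x)
      have opt: "pistar x \<in> zstar d Z f x" by (rule pistar_opt[OF elim(1)])
      have nn: "0 \<le> ip d (f x) (\<pi> x) - ip d (f x) (pistar x)"
        using opt Pol_Z[OF \<pi> elim(1)] by (auto simp: zstar_def)
      show ?case
      proof (cases "x \<in> ?N")
        case True
        then have "\<pi> x \<notin> zstar d Z f x" using opt elim(2) by auto
        note g = gap_le_of_ext_pt[OF fin_ext Pol_ext[OF \<pi> elim(1)] this opt]
        show ?thesis
        proof (cases "gap d Z f x \<le> \<epsilon> * B")
          case le: True
          then have "x \<in> ?G" using g by simp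
          then show ?thesis using True nn by simp
        next
          case False
          then have "x \<notin> ?G" by simp
          then show ?thesis using True g False by simp
        qed
      next
        case False
        then have "\<epsilon> * B * (indicator ?N x - indicator ?G x) \<le> 0" using \<epsilon> B by (simp add: indicator_def)
        then show ?thesis using nn by linarith
      qed
    qed
  qed
  moreover have "(\<integral>x. \<epsilon> * B * (indicator ?N x - indicator ?G x) \<partial>PX) = \<epsilon> * B * (disp \<pi> - measure PX ?G)"
    using iN iG G by (simp add: disp Bochner_Integration.integral_diff)
  \<comment> \<open>At \<open>\<delta> = \<epsilon> * B\<close> the scale \<open>B\<close> cancels
    in the noise condition.\<close>
  moreover have "measure PX ?G \<le> rpow \<gamma> \<alpha> * \<epsilon> powr \<alpha>"
    using noise[of "\<epsilon> * B"] rpow_mult_pos[OF \<gamma>0 \<epsilon>] \<epsilon> B by simp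
  then have "\<epsilon> * B * measure PX ?G \<le> \<epsilon> * B * (rpow \<gamma> \<alpha> * \<epsilon> powr \<alpha>)"
    using \<epsilon> B by (intro mult_left_mono) auto
  moreover have "\<epsilon> powr (1 + \<alpha>) = \<epsilon> * \<epsilon> powr \<alpha>" using \<epsilon> by (simp add: powr_add)
  ultimately show ?thesis by (simp add: algebra_simps)
qed

text \<open>Natarajan's bound for the at most \<open>2 * n\<close> points of a double
  sample.\<close>

definition growth :: real where
  "growth = (1 + 2 * real n * (real (card (ext_pts Z)))\<^sup>2) ^ \<eta>"

text \<open>\<open>loss\<close> and \<open>dis\<close> see a policy only through its values at the
  covariates of the good points of \<open>K\<close>, so their traces are at most as many as the
  restrictions of \<open>Pol\<close> to those covariates.\<close>

lemma behaviours:
  fixes \<kappa> :: real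
  defines "\<rho> \<equiv> \<lambda>K \<pi>. restrict (\<lambda>z. (2 * loss \<pi> z - \<kappa> * dis \<pi> z, dis \<pi> z)) K"
  assumes K: "finite K"
  shows "finite (\<rho> K ` Pol)"
    and "card K \<le> 2 * n \<Longrightarrow> real (card (\<rho> K ` Pol)) \<le> growth"
proof -
  define X where "X = fst ` (K \<inter> good)"
  let ?R = "(\<lambda>\<pi>. restrict \<pi> X) ` Pol"
  have X: "finite X" "X \<subseteq> vecs p" using K by (auto simp: X_def good_def)
  have "?R \<subseteq> X \<rightarrow>\<^sub>E ext_pts Z" using Pol_ext X by auto
  then have finR: "finite ?R" using X(1) fin_ext by (meson finite_PiE finite_subset)
  have "\<rho> K \<pi> = \<rho> K (restrict \<pi> X)" for \<pi>
  proof
    fix z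
    have "loss (restrict \<pi> X) z = loss \<pi> z" "dis (restrict \<pi> X) z = dis \<pi> z" if "z \<in> K"
      using that by (auto intro!: loss_cong dis_cong simp: X_def)
    then show "\<rho> K \<pi> z = \<rho> K (restrict \<pi> X) z" by (simp add: \<rho>_def restrict_def)
  qed
  then have img: "\<rho> K ` Pol = \<rho> K ` ?R" by (auto simp: image_image)
  then show "finite (\<rho> K ` Pol)" using finR by simp
  assume cK: "card K \<le> 2 * n"
  have "card X \<le> card (K \<inter> good)" unfolding X_def using K by (intro card_image_le) auto
  also have "\<dots> \<le> card K" using K by (intro card_mono) auto
  finally have cX: "card X \<le> 2 * n" using cK by simp
  have "card (\<rho> K ` Pol) \<le> card ?R" unfolding img using finR by (rule card_image_le)
  also have "\<dots> \<le> (1 + card X * (card (ext_pts Z))\<^sup>2) ^ \<eta>"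
    by (rule card_restrict_image_natarajan[OF X fin_ext _ Pol_dim]) (use Pol_ext X in auto)
  also have "\<dots> \<le> (1 + 2 * n * (card (ext_pts Z))\<^sup>2) ^ \<eta>"
    using cX by (intro power_mono add_left_mono mult_right_mono) auto
  finally have "real (card (\<rho> K ` Pol)) \<le> real ((1 + 2 * n * (card (ext_pts Z))\<^sup>2) ^ \<eta>)" by (simp only: of_nat_le_iff)
  then show "real (card (\<rho> K ` Pol)) \<le> growth" by (simp add: growth_def)
qed

lemma alg_integrals:
  shows "integrable Mn (\<lambda>D. risk (alg D))" "integrable Mn (\<lambda>D. disp (alg D))"
    and "\<And>D. D \<in> space Mn \<Longrightarrow> integrable P (loss (alg D))" "\<And>D. D \<in> space Mn \<Longrightarrow> integrable P (dis (alg D))"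
    and "\<And>i. i < n \<Longrightarrow> integrable Mn (\<lambda>D. loss (alg D) (D i))"
proof -
  interpret Mn: prob_space Mn by (rule prob_space_Mn)
  show l: "integrable P (loss (alg D))" if "D \<in> space Mn" for D
    using abs_loss_le'[OF alg_Pol[OF that]]
    by (intro integrable_bounded_abs single_measurable alg_coord_meas that)
  show t: "integrable P (dis (alg D))" if "D \<in> space Mn" for D
    by (rule integrable_bounded_abs[where b = 1])
      (use dis_bounds in \<open>auto intro!: single_measurable alg_coord_meas that\<close>)
  show "integrable Mn (\<lambda>D. risk (alg D))"
  proof (rule Mn.integrable_bounded_abs[where b = "2 * B"])
    show "(\<lambda>D. risk (alg D)) \<in> borel_measurable Mn"
      unfolding risk_def by (rule borel_measurable_lebesgue_integral[OF alg_loss_meas])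
    fix D assume D: "D \<in> space Mn"
    have "\<bar>risk (alg D)\<bar> \<le> (\<integral>z. \<bar>loss (alg D) z\<bar> \<partial>P)" unfolding risk_def by (rule integral_abs_bound)
    also have "\<dots> \<le> 2 * B"
      using abs_loss_le'[OF alg_Pol[OF D]] l[OF D] by (intro integral_le_const) auto
    finally show "\<bar>risk (alg D)\<bar> \<le> 2 * B" .
  qed
  show "integrable Mn (\<lambda>D. disp (alg D))"
  proof (rule Mn.integrable_bounded_abs[where b = 1])
    show "(\<lambda>D. disp (alg D)) \<in> borel_measurable Mn"
      unfolding disp_def by (rule borel_measurable_lebesgue_integral[OF alg_dis_meas])
    fix D assume D: "D \<in> space Mn"
    have "0 \<le> disp (alg D)" unfolding disp_def using dis_bounds by (intro integral_nonneg_AE) auto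
    moreover have "disp (alg D) \<le> 1" unfolding disp_def using dis_bounds t[OF D] by (intro integral_le_const) auto
    ultimately show "\<bar>disp (alg D)\<bar> \<le> 1" by simp
  qed
  show "integrable Mn (\<lambda>D. loss (alg D) (D i))" if i: "i < n" for i
  proof (rule Mn.integrable_bounded_abs)
    have "(\<lambda>D. (D, D i)) \<in> measurable Mn (Mn \<Otimes>\<^sub>M P)"
      using i by (intro measurable_Pair measurable_component_singleton) auto
    from measurable_compose[OF this alg_loss_meas]
    show "(\<lambda>D. loss (alg D) (D i)) \<in> borel_measurable Mn" by simp
    show "\<And>D. D \<in> space Mn \<Longrightarrow> \<bar>loss (alg D) (D i)\<bar> \<le> 2 * B" using abs_loss_le' alg_Pol by blast
  qed
qed

lemma AE_Mn_good: "AE D in Mn. \<forall>i\<in>{..<n}. D i \<in> good"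
  by (intro eventually_ball_finite ballI AE_PiM_component AE_good prob_space_axioms) auto

lemma alg_eq_erm: "\<forall>i\<in>{..<n}. D i \<in> good \<Longrightarrow> alg D = erm D"
  by (auto simp: alg_def good_def)

text \<open>By realizability \<open>pistar\<close> competes in the empirical minimisation, and
  samples with a point outside \<open>good\<close> form a null set.\<close>

lemma empirical_loss_nonpos: "(\<Sum>i<n. \<integral>D. loss (alg D) (D i) \<partial>Mn) \<le> 0"
proof -
  have "AE D in Mn. 0 \<le> - (\<Sum>i<n. loss (alg D) (D i))"
    using AE_Mn_good AE_space
  proof eventually_elim
    case (elim D)
    have v: "fst (D i) \<in> vecs p" if "i < n" for i using elim(1) that by (auto simp: good_def)
    have "(\<Sum>i<n. loss (alg D) (D i)) =
        (\<Sum>i<n. ip d (snd (D i)) (erm D (fst (D i)))) - (\<Sum>i<n. ip d (snd (D i)) (pistar (fst (D i))))"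
      unfolding sum_subtractf[symmetric] alg_eq_erm[OF elim(1)]
      using elim(1) by (intro sum.cong) (auto simp: loss_def)
    also have "\<dots> \<le> 0" using erm_min[OF elim(2) v pistar_Pol] by simp
    finally show ?case by simp
  qed
  then have "0 \<le> (\<integral>D. - (\<Sum>i<n. loss (alg D) (D i)) \<partial>Mn)" by (rule integral_nonneg_AE)
  also have "\<dots> = - (\<Sum>i<n. \<integral>D. loss (alg D) (D i) \<partial>Mn)"
    using alg_integrals(5) by (simp add: Bochner_Integration.integral_sum)
  finally show ?thesis by simp
qed

text \<open>On the sample side the offset cancels against the one inside \<open>?q\<close> and
  leaves twice the empirical loss, which is nonpositive; \<open>margin\<close> then removes the
  disagreement term on the population side.\<close>

lemma expected_risk_le:
  assumes B: "0 < B" and \<epsilon>: "0 < \<epsilon>" "\<epsilon> \<le> 1"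
  shows "(\<integral>D. risk (alg D) \<partial>Mn) \<le> 100 * B / (real n * \<epsilon>) * ln growth + rpow \<gamma> \<alpha> * B * \<epsilon> powr (1 + \<alpha>)"
proof -
  interpret Mn: prob_space Mn by (rule prob_space_Mn)
  \<comment> \<open>\<open>\<kappa>\<close> is subtracted once in \<open>?q\<close> and once as the
    offset, so the population term carries \<open>2 * \<kappa> = \<epsilon> * B\<close>, the
    coefficient in \<open>margin\<close>.\<close>
  define \<kappa> where "\<kappa> = \<epsilon> * B / 2"
  have \<kappa>: "0 < \<kappa>" "\<kappa> \<le> B" "\<kappa> \<le> 5 * B" using B \<epsilon> mult_right_mono[of \<epsilon> 1 B] by (auto simp: \<kappa>_def)
  let ?q = "\<lambda>\<pi> z. 2 * loss \<pi> z - \<kappa> * dis \<pi> z"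
  let ?R = "\<integral>D. risk (alg D) \<partial>Mn" and ?T = "\<integral>D. disp (alg D) \<partial>Mn"
  have sym: "real n * (\<integral>D. (\<integral>z. ?q (alg D) z - \<kappa> * dis (alg D) z \<partial>P) \<partial>Mn)
      - (\<Sum>i<n. \<integral>D. ?q (alg D) (D i) + \<kappa> * dis (alg D) (D i) \<partial>Mn) \<le> 2 * (5 * B)\<^sup>2 / \<kappa> * ln growth"
  proof (rule offset_symmetrization[where \<C> = Pol, OF alg_Pol])
    show "(\<lambda>(D, z). ?q (alg D) z) \<in> borel_measurable (Mn \<Otimes>\<^sub>M P)"
      using alg_loss_meas alg_dis_meas by (auto simp: case_prod_beta)
    show "(\<lambda>(D, z). dis (alg D) z) \<in> borel_measurable (Mn \<Otimes>\<^sub>M P)" by (rule alg_dis_meas)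
    \<comment> \<open>The factor 5 collects twice the loss bound \<open>2 * B\<close> and
      \<open>\<kappa> \<le> B\<close>.\<close>
    show "\<bar>?q \<pi> z\<bar> \<le> 5 * B * dis \<pi> z" if "\<pi> \<in> Pol" for \<pi> z
    proof -
      have "0 \<le> \<kappa> * dis \<pi> z" "\<kappa> * dis \<pi> z \<le> B * dis \<pi> z"
        using \<kappa> dis_bounds(1)[of \<pi> z] by (auto intro: mult_right_mono)
      then show ?thesis using abs_loss_le[OF that, of z] by linarith
    qed
  qed (use dis_bounds \<kappa> behaviours in auto)
  have ER: "(\<integral>D. (\<integral>z. ?q (alg D) z - \<kappa> * dis (alg D) z \<partial>P) \<partial>Mn) = 2 * ?R - 2 * \<kappa> * ?T"
  proof -
    have "(\<integral>z. ?q (alg D) z - \<kappa> * dis (alg D) z \<partial>P) = 2 * risk (alg D) - 2 * \<kappa> * disp (alg D)"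
      if "D \<in> space Mn" for D
      using alg_integrals(3,4)[OF that] by (simp add: risk_def disp_def)
    then have "(\<integral>D. (\<integral>z. ?q (alg D) z - \<kappa> * dis (alg D) z \<partial>P) \<partial>Mn)
        = (\<integral>D. 2 * risk (alg D) - 2 * \<kappa> * disp (alg D) \<partial>Mn)"
      by (intro Bochner_Integration.integral_cong) auto
    also have "\<dots> = 2 * ?R - 2 * \<kappa> * ?T" using alg_integrals(1,2) by simp
    finally show ?thesis .
  qed
  have ES: "(\<Sum>i<n. \<integral>D. ?q (alg D) (D i) + \<kappa> * dis (alg D) (D i) \<partial>Mn) = 2 * (\<Sum>i<n. \<integral>D. loss (alg D) (D i) \<partial>Mn)"
    by (simp add: sum_distrib_left)
  have main: "real n * (2 * ?R - 2 * \<kappa> * ?T) \<le> 2 * (5 * B)\<^sup>2 / \<kappa> * ln growth"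
    using sym empirical_loss_nonpos unfolding ER ES by linarith
  have "2 * (5 * B)\<^sup>2 / \<kappa> = 100 * B / \<epsilon>" using B \<epsilon> by (simp add: \<kappa>_def field_simps power2_eq_square)
  then have "(2 * ?R - 2 * \<kappa> * ?T) * real n \<le> 100 * B / \<epsilon> * ln growth"
    using main by (simp only: mult.commute)
  then have "2 * ?R - 2 * \<kappa> * ?T \<le> 100 * B / \<epsilon> * ln growth / real n"
    using n1 by (subst pos_le_divide_eq) auto
  then have main': "2 * ?R - 2 * \<kappa> * ?T \<le> 100 * B / (real n * \<epsilon>) * ln growth"
    by (simp add: mult.commute)
  have "(\<integral>D. \<epsilon> * B * disp (alg D) - rpow \<gamma> \<alpha> * B * \<epsilon> powr (1 + \<alpha>) \<partial>Mn) \<le> ?R"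
    using alg_integrals(1,2) margin[OF alg_Pol alg_coord_meas B \<epsilon>(1)] by (intro integral_mono) auto
  moreover have "(\<integral>D. \<epsilon> * B * disp (alg D) - rpow \<gamma> \<alpha> * B * \<epsilon> powr (1 + \<alpha>) \<partial>Mn)
      = 2 * \<kappa> * ?T - rpow \<gamma> \<alpha> * B * \<epsilon> powr (1 + \<alpha>)"
    using alg_integrals(2) by (simp add: \<kappa>_def Mn.prob_space)
  ultimately show ?thesis using main' by linarith
qed

text \<open>Settles \<open>B = 0\<close> and the samples too small for the complexity, where the
  rate exceeds 1.\<close>

lemma expected_risk_trivial: "(\<integral>D. risk (alg D) \<partial>Mn) \<le> 2 * B"
proof -
  interpret Mn: prob_space Mn by (rule prob_space_Mn)
  have "risk (alg D) \<le> 2 * B" if "D \<in> space Mn" for D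
    unfolding risk_def using abs_loss_le'[OF alg_Pol[OF that]] alg_integrals(3)[OF that]
    by (intro integral_le_const) (auto intro!: AE_I2 simp: abs_le_iff)
  then show ?thesis using alg_integrals(1) by (intro Mn.integral_le_const) auto
qed

text \<open>Almost every sample is good; there \<open>alg\<close> coincides with \<open>erm\<close>,
  and \<open>risk_eq\<close> evaluates the inner integral.\<close>

lemma regret_eq:
  "(\<integral>D. (\<integral>x. ip d (f x) (erm D x) - ip d (f x) (pistar x) \<partial>PX) \<partial>Mn) = (\<integral>D. risk (alg D) \<partial>Mn)"
proof (rule integral_cong_AE)
  interpret PX: prob_space PX by (rule prob_space_PX)
  have e: "(\<lambda>w. erm (fst w) (snd w) i) \<in> borel_measurable (Mn \<Otimes>\<^sub>M PX)" if "i < d" for i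
    using erm_meas[OF that] by (simp add: case_prod_beta)
  have s: "(\<lambda>w. pistar (snd w) i) \<in> borel_measurable (Mn \<Otimes>\<^sub>M PX)" if "i < d" for i
    using measurable_compose[OF measurable_snd, of "\<lambda>x. pistar x i" PX] pistar_meas[OF that] by simp
  have f: "(\<lambda>w. f (snd w) i) \<in> borel_measurable (Mn \<Otimes>\<^sub>M PX)" if "i < d" for i
    using measurable_compose[OF measurable_snd, of "\<lambda>x. f x i" PX] f_meas[OF that] by simp
  show "(\<lambda>D. \<integral>x. ip d (f x) (erm D x) - ip d (f x) (pistar x) \<partial>PX) \<in> borel_measurable Mn"
    by (rule PX.borel_measurable_lebesgue_integral, unfold case_prod_beta)
      (intro borel_measurable_diff borel_measurable_ip e s f)
  show "(\<lambda>D. risk (alg D)) \<in> borel_measurable Mn" using alg_integrals(1) by auto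
  show "AE D in Mn. (\<integral>x. ip d (f x) (erm D x) - ip d (f x) (pistar x) \<partial>PX) = risk (alg D)"
    using AE_Mn_good AE_space
  proof eventually_elim
    case (elim D)
    show ?case using risk_eq(2)[OF alg_Pol alg_coord_meas, OF elim(2) elim(2)] alg_eq_erm[OF elim(1)] by simp
  qed
qed

section \<open>From the growth bound to the rate\<close>

lemma card_ext_pos: "1 \<le> card (ext_pts Z)"
  using Pol_ext[OF pistar_Pol zero_vecs] fin_ext card_gt_0_iff[of "ext_pts Z"] by (simp add: Suc_le_eq) blast

abbreviation complexity :: real where
  "complexity \<equiv> real \<eta> * ln (real (card (ext_pts Z)) + 1) * ln (real n + 1)"

text \<open>The base of \<open>growth\<close> is at most the square of the product of
  \<open>n + 1\<close> and \<open>card (ext_pts Z) + 1\<close>; its logarithm is a sum of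
  logarithms, which the lower bound on \<open>ln 2\<close> turns into a product.\<close>

lemma ln_growth_le: "ln growth \<le> 6 * complexity"
proof -
  define k m where "k = real (card (ext_pts Z)) + 1" and "m = real n + 1"
  have km: "2 \<le> k" "2 \<le> m" using card_ext_pos n1 by (auto simp: k_def m_def)
  have "1 + 2 * real n * (real (card (ext_pts Z)))\<^sup>2 \<le> m\<^sup>2 * k\<^sup>2"
  proof -
    have "1 + 2 * real n * (real (card (ext_pts Z)))\<^sup>2 \<le> (1 + 2 * real n) * k\<^sup>2"
    proof -
      have "(real (card (ext_pts Z)))\<^sup>2 \<le> k\<^sup>2" by (intro power_mono) (auto simp: k_def)
      then have "2 * real n * (real (card (ext_pts Z)))\<^sup>2 \<le> 2 * real n * k\<^sup>2" by (intro mult_left_mono) auto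
      moreover have "1 \<le> k\<^sup>2" using km by (simp add: one_le_power)
      ultimately show ?thesis by (simp add: algebra_simps)
    qed
    also have "\<dots> \<le> m\<^sup>2 * k\<^sup>2" by (intro mult_right_mono) (auto simp: m_def power2_eq_square algebra_simps)
    finally show ?thesis .
  qed
  then have "ln (1 + 2 * real n * (real (card (ext_pts Z)))\<^sup>2) \<le> ln (m\<^sup>2 * k\<^sup>2)"
    by (subst ln_le_cancel_iff) (use km in \<open>auto intro!: add_pos_nonneg\<close>)
  also have "\<dots> = 2 * (ln m + ln k)" using km by (simp add: ln_mult ln_realpow)
  \<comment> \<open>Both logarithms are at least \<open>2 / 3\<close>, so each is at most
    \<open>3 / 2\<close> times their product; the two together, doubled, give 6.\<close>
  also have "\<dots> \<le> 6 * (ln k * ln m)"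
  proof -
    have l: "2 / 3 \<le> ln k" "2 / 3 \<le> ln m"
      using ln2_ge_two_thirds ln_le_cancel_iff[of 2 k] ln_le_cancel_iff[of 2 m] km by linarith+
    have "2 / 3 * ln m \<le> ln k * ln m" "2 / 3 * ln k \<le> ln m * ln k"
      using l by (auto intro!: mult_right_mono)
    then show ?thesis by (simp add: algebra_simps)
  qed
  finally have "real \<eta> * ln (1 + 2 * real n * (real (card (ext_pts Z)))\<^sup>2) \<le> real \<eta> * (6 * (ln k * ln m))"
    by (intro mult_left_mono) auto
  moreover have "ln growth = real \<eta> * ln (1 + 2 * real n * (real (card (ext_pts Z)))\<^sup>2)"
    unfolding growth_def by (rule ln_realpow)
  ultimately show ?thesis by (simp add: k_def m_def algebra_simps)
qed

text \<open>The balancing \<open>\<epsilon>\<close> is positive and at most 1 only when the ratio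
  \<open>r\<close> is, so the other values of \<open>r\<close> are treated apart. The constant 602
  joins the 600 of the balanced bound and the 2 of the trivial one.\<close>

lemma expected_risk_rate:
  assumes \<alpha>: "0 \<le> \<alpha>"
  shows "(\<integral>D. risk (alg D) \<partial>Mn) \<le> (602 + rpow \<gamma> \<alpha>) * B * (complexity / real n) powr ((1 + \<alpha>) / (2 + \<alpha>))"
proof -
  let ?R = "\<integral>D. risk (alg D) \<partial>Mn" and ?c = "rpow \<gamma> \<alpha>"
  define r where "r = complexity / real n"
  have r0: "0 \<le> r" by (simp add: r_def)
  have c0: "0 \<le> ?c" by (rule rpow_nonneg)
  have bound: "?R \<le> 600 * B * (r / \<epsilon>) + ?c * B * \<epsilon> powr (1 + \<alpha>)" if "0 < B" "0 < \<epsilon>" "\<epsilon> \<le> 1" for \<epsilon>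
  proof -
    have "100 * B / (real n * \<epsilon>) * ln growth \<le> 100 * B / (real n * \<epsilon>) * (6 * complexity)"
      using that ln_growth_le by (intro mult_left_mono) auto
    also have "\<dots> = 600 * B * (r / \<epsilon>)" by (simp add: r_def)
    finally show ?thesis using expected_risk_le[OF that] by linarith
  qed
  consider "B = 0" | "0 < B" "r = 0" | "0 < B" "1 < r" | "0 < B" "0 < r" "r \<le> 1"
    using B_nonneg r0 by linarith
  then have "?R \<le> (602 + ?c) * B * r powr ((1 + \<alpha>) / (2 + \<alpha>))"
  proof cases
    case 1
    then show ?thesis using expected_risk_trivial by simp
  next
    case 2
    \<comment> \<open>With \<open>r = 0\<close> the first term of \<open>bound\<close> vanishes, and
      letting \<open>\<epsilon>\<close> tend to 0 removes the second.\<close>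
    have "?R \<le> 0"
    proof (rule field_le_epsilon)
      fix e :: real assume e: "0 < e"
      define \<epsilon> where "\<epsilon> = min 1 (e / (?c * B + 1))"
      have cB: "0 \<le> ?c * B" using c0 2 by simp
      have \<epsilon>: "0 < \<epsilon>" "\<epsilon> \<le> 1" using e cB by (auto simp: \<epsilon>_def)
      have "\<epsilon> \<le> e / (?c * B + 1)" by (simp add: \<epsilon>_def)
      then have \<epsilon>e: "\<epsilon> * (?c * B + 1) \<le> e" using cB by (subst (asm) pos_le_divide_eq) auto
      have "\<epsilon> powr (1 + \<alpha>) \<le> \<epsilon> powr 1" using \<epsilon> \<alpha> by (intro powr_mono') auto
      then have "?c * B * \<epsilon> powr (1 + \<alpha>) \<le> ?c * B * \<epsilon>" using cB \<epsilon> by (intro mult_left_mono) auto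
      then show "?R \<le> 0 + e" using bound[OF 2(1) \<epsilon>] 2(2) \<epsilon> \<epsilon>e by (simp add: algebra_simps)
    qed
    then show ?thesis using 2 by simp
  next
    case 3
    \<comment> \<open>Here the power is at least 1, so the trivial bound \<open>2 * B\<close>
      suffices.\<close>
    have "1 \<le> r powr ((1 + \<alpha>) / (2 + \<alpha>))" using 3 \<alpha> by (intro ge_one_powr_ge_zero) auto
    then have "2 * B * 1 \<le> (602 + ?c) * B * r powr ((1 + \<alpha>) / (2 + \<alpha>))"
      using 3 c0 by (intro mult_mono) auto
    then show ?thesis using expected_risk_trivial by linarith
  next
    case 4
    define \<epsilon> where "\<epsilon> = r powr (1 / (2 + \<alpha>))"
    have \<epsilon>: "0 < \<epsilon>" "\<epsilon> \<le> 1" using 4 \<alpha> by (auto simp: \<epsilon>_def intro!: powr_le1)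
    have "\<epsilon> powr (1 + \<alpha>) = r powr ((1 + \<alpha>) / (2 + \<alpha>))"
      by (simp add: \<epsilon>_def powr_powr)
    moreover have "r / \<epsilon> = r powr ((1 + \<alpha>) / (2 + \<alpha>))"
    proof -
      have "r / \<epsilon> = r powr 1 / r powr (1 / (2 + \<alpha>))" using 4 by (simp add: \<epsilon>_def)
      also have "\<dots> = r powr (1 - 1 / (2 + \<alpha>))" by (rule powr_diff[symmetric])
      also have "1 - 1 / (2 + \<alpha>) = (1 + \<alpha>) / (2 + \<alpha>)" using \<alpha> by (simp add: field_simps)
      finally show ?thesis .
    qed
    ultimately have "?R \<le> (600 + ?c) * B * r powr ((1 + \<alpha>) / (2 + \<alpha>))"
      using bound[OF 4(1) \<epsilon>] by (simp add: algebra_simps)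
    also have "\<dots> \<le> (602 + ?c) * B * r powr ((1 + \<alpha>) / (2 + \<alpha>))"
      using 4 by (intro mult_right_mono) auto
    finally show ?thesis .
  qed
  then show ?thesis by (simp add: r_def)
qed

end

theorem theorem6:
  fixes \<alpha> \<gamma> :: real
  assumes "0 \<le> \<alpha>" and "0 \<le> \<gamma>"
  shows "\<exists>C::real. \<forall>(p::nat) (d::nat)
      (P :: ((nat \<Rightarrow> real) \<times> (nat \<Rightarrow> real)) measure)
      (f :: (nat \<Rightarrow> real) \<Rightarrow> (nat \<Rightarrow> real))
      (Z :: (nat \<Rightarrow> real) set) (B::real)
      (Pol :: ((nat \<Rightarrow> real) \<Rightarrow> (nat \<Rightarrow> real)) set) (\<eta>::nat) (n::nat)
      (pistar :: (nat \<Rightarrow> real) \<Rightarrow> (nat \<Rightarrow> real))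
      (erm :: (nat \<Rightarrow> (nat \<Rightarrow> real) \<times> (nat \<Rightarrow> real)) \<Rightarrow> (nat \<Rightarrow> real) \<Rightarrow> (nat \<Rightarrow> real)).
    let PX = distr P borel fst;
        Pn = PiM {..<n} (\<lambda>_. P)
    in
    ( \<comment> \<open>data distribution: X in R^p, Y in R^d, norm Y <= 1\<close>
      prob_space P \<and> sets P = sets (borel \<Otimes>\<^sub>M borel) \<and>
      (AE z in P. fst z \<in> vecs p \<and> snd z \<in> vecs d \<and> vnorm d (snd z) \<le> 1) \<and>
      \<comment> \<open>f = E[Y | X = x]\<close>
      (\<forall>x. f x \<in> vecs d) \<and>
      (\<forall>i<d. (\<lambda>x. f x i) \<in> borel_measurable borel \<and> integrable PX (\<lambda>x. f x i) \<and>
         (\<forall>A\<in>sets borel. (\<integral>z. indicator A (fst z) * snd z i \<partial>P) = (\<integral>x. indicator A x * f x i \<partial>PX))) \<and>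
      \<comment> \<open>polytope Z with sup norm <= B\<close>
      is_Hpoly d Z \<and> (\<forall>z\<in>Z. vnorm d z \<le> B) \<and>
      \<comment> \<open>noise (margin) condition\<close>
      (\<forall>\<delta>>0. measure PX {x. 0 < gap d Z f x \<and> gap d Z f x \<le> \<delta>} \<le> rpow (\<gamma> * \<delta> / B) \<alpha>) \<and>
      \<comment> \<open>P(|Z*(X)| > 1) = 0\<close>
      (AE x in PX. \<forall>z\<in>zstar d Z f x. \<forall>w\<in>zstar d Z f x. z = w) \<and>
      \<comment> \<open>policy class into extreme points, Natarajan dim <= eta, realizable\<close>
      (\<forall>\<pi>\<in>Pol. \<forall>x\<in>vecs p. \<pi> x \<in> ext_pts Z) \<and>
      natarajan_dim (vecs p) Pol \<le> enat \<eta> \<and>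
      (\<forall>x\<in>vecs p. pistar x \<in> zstar d Z f x) \<and> pistar \<in> Pol \<and>
      \<comment> \<open>ERM over Pol from n i.i.d. samples\<close>
      1 \<le> n \<and>
      (\<forall>D\<in>space Pn. (\<forall>i<n. fst (D i) \<in> vecs p) \<longrightarrow>
         erm D \<in> Pol \<and>
         (\<forall>\<pi>\<in>Pol. (\<Sum>i<n. ip d (snd (D i)) (erm D (fst (D i))))
                    \<le> (\<Sum>i<n. ip d (snd (D i)) (\<pi> (fst (D i)))))) \<and>
      \<comment> \<open>measurability (implicit in the paper)\<close>
      (\<forall>i<d. (\<lambda>(D, x). erm D x i) \<in> borel_measurable (Pn \<Otimes>\<^sub>M borel) \<and>
              (\<lambda>x. pistar x i) \<in> borel_measurable borel)
    ) \<longrightarrow>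
    (\<integral>D. (\<integral>x. ip d (f x) (erm D x) - ip d (f x) (pistar x) \<partial>PX) \<partial>Pn)
      \<le> C * B * ((real \<eta> * ln (real (card (ext_pts Z)) + 1) * ln (real n + 1)) / real n)
               powr ((1 + \<alpha>) / (2 + \<alpha>))"
proof (intro exI[of _ "602 + rpow \<gamma> \<alpha>"] allI, unfold Let_def, intro impI, elim conjE)
  fix p d :: nat and P :: "((nat \<Rightarrow> real) \<times> (nat \<Rightarrow> real)) measure"
    and f :: "(nat \<Rightarrow> real) \<Rightarrow> nat \<Rightarrow> real" and Z :: "(nat \<Rightarrow> real) set" and B :: real
    and Pol :: "((nat \<Rightarrow> real) \<Rightarrow> nat \<Rightarrow> real) set" and \<eta> n :: nat
    and pistar :: "(nat \<Rightarrow> real) \<Rightarrow> nat \<Rightarrow> real"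
    and erm :: "(nat \<Rightarrow> (nat \<Rightarrow> real) \<times> (nat \<Rightarrow> real)) \<Rightarrow> (nat \<Rightarrow> real) \<Rightarrow> nat \<Rightarrow> real"
  let ?PX = "distr P borel fst" and ?Pn = "PiM {..<n} (\<lambda>_. P)"
  assume P: "prob_space P" and setsP: "sets P = sets (borel \<Otimes>\<^sub>M borel)"
    and ae: "AE z in P. fst z \<in> vecs p \<and> snd z \<in> vecs d \<and> vnorm d (snd z) \<le> 1"
    and fv: "\<forall>x. f x \<in> vecs d"
    and fc: "\<forall>i<d. (\<lambda>x. f x i) \<in> borel_measurable borel \<and> integrable ?PX (\<lambda>x. f x i) \<and>
         (\<forall>A\<in>sets borel. (\<integral>z. indicator A (fst z) * snd z i \<partial>P) = (\<integral>x. indicator A x * f x i \<partial>?PX))"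
    and Z: "is_Hpoly d Z" "\<forall>z\<in>Z. vnorm d z \<le> B"
    and noise: "\<forall>\<delta>>0. measure ?PX {x. 0 < gap d Z f x \<and> gap d Z f x \<le> \<delta>} \<le> rpow (\<gamma> * \<delta> / B) \<alpha>"
    and uniq: "AE x in ?PX. \<forall>z\<in>zstar d Z f x. \<forall>w\<in>zstar d Z f x. z = w"
    and Pol: "\<forall>\<pi>\<in>Pol. \<forall>x\<in>vecs p. \<pi> x \<in> ext_pts Z" "natarajan_dim (vecs p) Pol \<le> enat \<eta>"
    and ps: "\<forall>x\<in>vecs p. pistar x \<in> zstar d Z f x" "pistar \<in> Pol" and n: "1 \<le> n"
    and erm: "\<forall>D\<in>space ?Pn. (\<forall>i<n. fst (D i) \<in> vecs p) \<longrightarrow> erm D \<in> Pol \<and>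
         (\<forall>\<pi>\<in>Pol. (\<Sum>i<n. ip d (snd (D i)) (erm D (fst (D i))))
                    \<le> (\<Sum>i<n. ip d (snd (D i)) (\<pi> (fst (D i)))))"
    and ms: "\<forall>i<d. (\<lambda>(D, x). erm D x i) \<in> borel_measurable (?Pn \<Otimes>\<^sub>M borel) \<and>
              (\<lambda>x. pistar x i) \<in> borel_measurable borel"
  interpret prob_space P by (rule P)
  interpret policy_learning P n p d \<eta> \<alpha> \<gamma> B f pistar Z Pol erm
    by unfold_locales
      (use assms setsP ae fv fc Z noise uniq Pol ps n erm ms in \<open>(blast | simp)+\<close>)
  show "(\<integral>D. (\<integral>x. ip d (f x) (erm D x) - ip d (f x) (pistar x) \<partial>?PX) \<partial>?Pn)
      \<le> (602 + rpow \<gamma> \<alpha>) * B * ((real \<eta> * ln (real (card (ext_pts Z)) + 1) * ln (real n + 1)) / real n)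
               powr ((1 + \<alpha>) / (2 + \<alpha>))"
    unfolding regret_eq by (rule expected_risk_rate[OF assms(1)])
qed

end
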